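(* Let $T>0$, $H\in(0,1]$, and let $B^H=(B^H_t)_{t\in[0,T]}$ be a fractional Brownian motion with Hurst constant $H$, i.e. a continuous centered Gaussian process with covariance function $$C^H(s,t)=\tfrac12\big(t^{2H}+s^{2H}-|t-s|^{2H}\big),\qquad s,t\in[0,T].$$ Then $B^H$ satisfies a functional co-monotony principle on $\mathcal{C}([0,T],\mathbb{R})$.
   Context: $\mathcal{C}([0,T],\mathbb{R})$ is equipped with the sup-norm, its Borel $\sigma$-field, and the pointwise order: $\alpha\le\beta$ if $\alpha(t)\le\beta(t)$ for all $t\in[0,T]$. Two measurable functionals $F,G$ on this space are co-monotone if they are both non-decreasing or both non-increasing for this order. $F$ is $\mathbb{P}_X$-a.s. continuous if it is sup-norm continuous at every point of a set of probability $1$ under the distribution $\mathbb{P}_X$ of $X$. A continuous process $X$ satisfies a functional co-monotony principle on $\mathcal{C}([0,T],\mathbb{R})$ if, for every pair of bounded, co-monotone, $\mathbb{P}_X$-a.s. continuous, measurable functionals $F,G:\mathcal{C}([0,T],\mathbb{R})\to\mathbb{R}$, $\mathbb{E}\,F(X)G(X)\ge\mathbb{E}\,F(X)\,\mathbb{E}\,G(X)$. *)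

theory Defs
  imports "HOL-Probability.Probability"
begin

section \<open>The space of continuous functions on a compact interval\<close>

text \<open>
  Elements of \<open>cfunspace\<close> are extensional, i.e. \<open>undefined\<close> off \<open>{0..T}\<close>, so that equality of
  elements is equality on \<open>{0..T}\<close>. Its metric is the sup-distance; boundedness is automatic
  by compactness, see \<open>mspace_C_metric\<close>.
\<close>

definition C_metric :: "real \<Rightarrow> (real \<Rightarrow> real) metric" where
  "C_metric T = cfunspace (top_of_set {0..T}) euclidean_metric"

abbreviation C_space :: "real \<Rightarrow> (real \<Rightarrow> real) set" where
  "C_space T \<equiv> mspace (C_metric T)"

abbreviation C_topology :: "real \<Rightarrow> (real \<Rightarrow> real) topology" where
  "C_topology T \<equiv> mtopology_of (C_metric T)"

definition C_borel :: "real \<Rightarrow> (real \<Rightarrow> real) measure" where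
  "C_borel T = sigma (C_space T) {U. openin (C_topology T) U}"

definition C_le :: "real \<Rightarrow> (real \<Rightarrow> real) \<Rightarrow> (real \<Rightarrow> real) \<Rightarrow> bool" where
  "C_le T \<alpha> \<beta> \<longleftrightarrow> (\<forall>t\<in>{0..T}. \<alpha> t \<le> \<beta> t)"

lemma mspace_C_metric:
  "C_space T = {f \<in> extensional {0..T}. continuous_on {0..T} f}"
proof -
  have "bounded (f ` {0..T})" if "continuous_on {0..T} f" for f :: "real \<Rightarrow> real"
    using that by (intro compact_imp_bounded compact_continuous_image) auto
  then show ?thesis
    unfolding C_metric_def mspace_cfunspace by auto
qed


section \<open>Functional co-monotony\<close>

definition comonotone :: "real \<Rightarrow> ((real \<Rightarrow> real) \<Rightarrow> real) \<Rightarrow> ((real \<Rightarrow> real) \<Rightarrow> real) \<Rightarrow> bool" where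
  "comonotone T F G \<longleftrightarrow>
     (monotone_on (C_space T) (C_le T) (\<le>) F \<and> monotone_on (C_space T) (C_le T) (\<le>) G) \<or>
     (monotone_on (C_space T) (C_le T) (\<ge>) F \<and> monotone_on (C_space T) (C_le T) (\<ge>) G)"

definition sample_path :: "real \<Rightarrow> (real \<Rightarrow> 'w \<Rightarrow> real) \<Rightarrow> 'w \<Rightarrow> real \<Rightarrow> real" where
  "sample_path T X \<omega> = (\<lambda>t\<in>{0..T}. X t \<omega>)"

definition continuous_process :: "'w measure \<Rightarrow> real \<Rightarrow> (real \<Rightarrow> 'w \<Rightarrow> real) \<Rightarrow> bool" where
  "continuous_process M T X \<longleftrightarrow>
     (\<forall>t\<in>{0..T}. X t \<in> borel_measurable M) \<and>
     (\<forall>\<omega>\<in>space M. continuous_on {0..T} (\<lambda>t. X t \<omega>))"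

definition path_law :: "'w measure \<Rightarrow> real \<Rightarrow> (real \<Rightarrow> 'w \<Rightarrow> real) \<Rightarrow> (real \<Rightarrow> real) measure" where
  "path_law M T X = distr M (C_borel T) (sample_path T X)"

definition as_continuous :: "real \<Rightarrow> (real \<Rightarrow> real) measure \<Rightarrow> ((real \<Rightarrow> real) \<Rightarrow> real) \<Rightarrow> bool" where
  "as_continuous T P F \<longleftrightarrow>
     (\<exists>A\<in>sets P. measure P A = 1 \<and> (\<forall>\<alpha>\<in>A. topcontinuous_at (C_topology T) euclidean F \<alpha>))"

text \<open>Only meaningful for continuous processes, whose paths are random elements of \<open>C_space T\<close>.\<close>

definition functional_comonotony_principle ::
    "'w measure \<Rightarrow> real \<Rightarrow> (real \<Rightarrow> 'w \<Rightarrow> real) \<Rightarrow> bool" where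
  "functional_comonotony_principle M T X \<longleftrightarrow>
     (\<forall>F G. F \<in> borel_measurable (C_borel T) \<longrightarrow> G \<in> borel_measurable (C_borel T) \<longrightarrow>
        bounded (F ` C_space T) \<longrightarrow> bounded (G ` C_space T) \<longrightarrow>
        comonotone T F G \<longrightarrow>
        as_continuous T (path_law M T X) F \<longrightarrow> as_continuous T (path_law M T X) G \<longrightarrow>
        (\<integral>\<omega>. F (sample_path T X \<omega>) * G (sample_path T X \<omega>) \<partial>M) \<ge>
          (\<integral>\<omega>. F (sample_path T X \<omega>) \<partial>M) * (\<integral>\<omega>. G (sample_path T X \<omega>) \<partial>M))"


section \<open>Fractional Brownian motion\<close>

text \<open>
  The degenerate case \<open>\<sigma> = 0\<close> has to be allowed: fractional Brownian motion vanishes at time 0,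
  and for \<open>H = 1\<close> all its values are multiples of a single Gaussian variable.
\<close>

definition gaussian_measure :: "real \<Rightarrow> real \<Rightarrow> real measure" where
  "gaussian_measure \<mu> \<sigma> =
     (if \<sigma> = 0 then return borel \<mu> else density lborel (\<lambda>x. ennreal (normal_density \<mu> \<sigma> x)))"

definition gaussian_variable :: "'w measure \<Rightarrow> ('w \<Rightarrow> real) \<Rightarrow> bool" where
  "gaussian_variable M Y \<longleftrightarrow>
     Y \<in> borel_measurable M \<and> (\<exists>\<mu> \<sigma>. \<sigma> \<ge> 0 \<and> distr M borel Y = gaussian_measure \<mu> \<sigma>)"

definition gaussian_process :: "'w measure \<Rightarrow> real \<Rightarrow> (real \<Rightarrow> 'w \<Rightarrow> real) \<Rightarrow> bool" where
  "gaussian_process M T X \<longleftrightarrow>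
     (\<forall>I c. finite I \<longrightarrow> I \<subseteq> {0..T} \<longrightarrow> gaussian_variable M (\<lambda>\<omega>. \<Sum>t\<in>I. c t * X t \<omega>))"

definition centered :: "'w measure \<Rightarrow> real \<Rightarrow> (real \<Rightarrow> 'w \<Rightarrow> real) \<Rightarrow> bool" where
  "centered M T X \<longleftrightarrow> (\<forall>t\<in>{0..T}. (\<integral>\<omega>. X t \<omega> \<partial>M) = 0)"

definition covariance :: "'w measure \<Rightarrow> ('w \<Rightarrow> real) \<Rightarrow> ('w \<Rightarrow> real) \<Rightarrow> real" where
  "covariance M Y Z =
     (\<integral>\<omega>. (Y \<omega> - (\<integral>\<omega>'. Y \<omega>' \<partial>M)) * (Z \<omega> - (\<integral>\<omega>'. Z \<omega>' \<partial>M)) \<partial>M)"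

definition fbm_covariance :: "real \<Rightarrow> real \<Rightarrow> real \<Rightarrow> real" where
  "fbm_covariance H s t = (t powr (2 * H) + s powr (2 * H) - \<bar>t - s\<bar> powr (2 * H)) / 2"

definition fractional_brownian_motion ::
    "'w measure \<Rightarrow> real \<Rightarrow> real \<Rightarrow> (real \<Rightarrow> 'w \<Rightarrow> real) \<Rightarrow> bool" where
  "fractional_brownian_motion M T H X \<longleftrightarrow>
     continuous_process M T X \<and> gaussian_process M T X \<and> centered M T X \<and>
     (\<forall>s\<in>{0..T}. \<forall>t\<in>{0..T}. covariance M (X s) (X t) = fbm_covariance H s t)"

end

theory Submission
  imports Defs
begin

text \<open>
  Since \<open>C\<^sup>H \<ge> 0\<close>, Pitt's theorem applies: a centered Gaussian vector \<open>X\<close> with nonnegative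
  covariances is associated. For smooth monotone \<open>f\<close>, \<open>g\<close>, write \<open>X\<close> in law as a sum of \<open>N\<close>
  independent copies of \<open>X / \<surd>N\<close>. To first order, each step contributes the covariance of two linear
  forms in \<open>X / \<surd>N\<close> with nonnegative coefficients (the gradients of the averaged functions), which is
  nonnegative; the Taylor errors are \<open>O(N powr (-3/2))\<close> each and \<open>O(1 / \<surd>N)\<close> in total.

  A functional \<open>F\<close> on the path space is replaced by its inf-convolution
  \<open>\<alpha> \<mapsto> INF \<beta>. F \<beta> + L * dist \<alpha> \<beta>\<close>, which is monotone and Lipschitz and converges to \<open>F\<close> as
  \<open>L \<rightarrow> \<infinity>\<close> wherever \<open>F\<close> is continuous. Evaluated at Bernstein polynomials, which depend
  monotonically on their nodes, it is a function of finitely many values of the process.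
\<close>

section \<open>Laws of random sequences\<close>

text \<open>The vectors in play may be singular: the process vanishes almost surely at time 0, is
  essentially one-dimensional for \<open>H = 1\<close>, and grid times repeat. There is no density
  to differentiate, so the argument uses only expectations of \<open>f\<close> at randomly shifted
  points. Adding independent copies becomes composing such averages; the one fact needed, that two
  scaled copies add up to a scaled copy, concerns joint laws, whence the Cramer-Wold theorem at the
  start. A step of size \<open>h\<close> loses only \<open>O(h ^ 3)\<close> although Taylor
  remainders are \<open>O(h ^ 2)\<close>: remainders multiplied by constants cancel between the mean
  of the product and the product of the means, and those multiplied by linear forms gain a factor
  \<open>h\<close>. Without this gain the errors of \<open>N\<close> steps of size
  \<open>1 / sqrt N\<close> would not vanish. Averaging keeps bounds, Lipschitz constants and Taylor
  constants, so one error constant serves every step. The finite-dimensional inequality is proved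
  for Lipschitz functions, while a functional on paths is only almost surely continuous; hence
  Lipschitz regularization precedes discretization.\<close>

lemma weighted_distr_eqI:
  fixes M :: "'a measure" and N :: "'b measure" and C :: real
  assumes "prob_space M" "prob_space N"
    and [measurable]: "w \<in> borel_measurable M" "v \<in> borel_measurable N"
    and w: "\<And>x. 0 \<le> w x" "\<And>x. w x \<le> C" and v: "\<And>x. 0 \<le> v x" "\<And>x. v x \<le> C"
    and [measurable]: "Z \<in> borel_measurable M" "Y \<in> borel_measurable N"
    and eq: "\<And>t s::real. (\<integral>x. w x * cos (t * Z x + s) \<partial>M) = (\<integral>x. v x * cos (t * Y x + s) \<partial>N)"
    and [measurable]: "A \<in> sets borel"
  shows "(\<integral>x. w x * indicator A (Z x) \<partial>M) = (\<integral>x. v x * indicator A (Y x) \<partial>N)"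
proof -
  interpret M: prob_space M by fact
  interpret N: prob_space N by fact
  \<comment> \<open>The common total mass of the two weighted measures. If positive, dividing by it
    yields laws of \<open>Z\<close> and \<open>Y\<close> to which uniqueness of characteristic
    functions applies; if zero, both integrals are squeezed between \<open>0\<close> and
    \<open>m\<close>.\<close>
  define m where "m = (\<integral>x. w x \<partial>M)"
  have mN: "m = (\<integral>x. v x \<partial>N)"
    using eq[of 0 0] by (simp add: m_def)
  have iw: "integrable M w" and iv: "integrable N v"
    using w v by (auto intro!: M.integrable_const_bound[where B=C] N.integrable_const_bound[where B=C])
  have iwA: "integrable M (\<lambda>x. w x * indicator A (Z x))"
    by (rule Bochner_Integration.integrable_bound[OF iw]) (auto simp: indicator_def)
  have ivA: "integrable N (\<lambda>x. v x * indicator A (Y x))"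
    by (rule Bochner_Integration.integrable_bound[OF iv]) (auto simp: indicator_def)
  have m0: "m \<ge> 0" using w by (auto simp: m_def)
  show ?thesis
  proof (cases "m = 0")
    case True
    have "(\<integral>x. w x * indicator A (Z x) \<partial>M) \<le> m"
      unfolding m_def by (intro integral_mono iwA iw) (use w in \<open>auto simp: indicator_def\<close>)
    moreover have "(\<integral>x. v x * indicator A (Y x) \<partial>N) \<le> m"
      unfolding mN by (intro integral_mono ivA iv) (use v in \<open>auto simp: indicator_def\<close>)
    moreover have "0 \<le> (\<integral>x. w x * indicator A (Z x) \<partial>M)" "0 \<le> (\<integral>x. v x * indicator A (Y x) \<partial>N)"
      using w v by (auto intro!: integral_nonneg_AE)
    ultimately show ?thesis using True by simp
  next
    case False
    with m0 have mp: "m > 0" by simp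
    define P where "P = distr (density M (\<lambda>x. ennreal (w x / m))) borel Z"
    define Q where "Q = distr (density N (\<lambda>x. ennreal (v x / m))) borel Y"
    have "prob_space (density M (\<lambda>x. ennreal (w x / m)))"
    proof
      have "(\<integral>\<^sup>+x. ennreal (w x / m) \<partial>M) = ennreal (\<integral>x. w x / m \<partial>M)"
        by (rule nn_integral_eq_integral) (use iw w m0 in auto)
      then show "emeasure (density M (\<lambda>x. ennreal (w x / m))) (space (density M (\<lambda>x. ennreal (w x / m)))) = 1"
        using mp by (simp add: emeasure_density nn_integral_set_ennreal m_def[symmetric] cong: nn_integral_cong_simp)
    qed
    then have "prob_space P" unfolding P_def by (rule prob_space.prob_space_distr) simp
    then have P: "real_distribution P"
      by (simp add: real_distribution_def real_distribution_axioms_def P_def)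
    have "prob_space (density N (\<lambda>x. ennreal (v x / m)))"
    proof
      have "(\<integral>\<^sup>+x. ennreal (v x / m) \<partial>N) = ennreal (\<integral>x. v x / m \<partial>N)"
        by (rule nn_integral_eq_integral) (use iv v m0 in auto)
      then show "emeasure (density N (\<lambda>x. ennreal (v x / m))) (space (density N (\<lambda>x. ennreal (v x / m)))) = 1"
        using mp by (simp add: emeasure_density nn_integral_set_ennreal mN[symmetric] cong: nn_integral_cong_simp)
    qed
    then have "prob_space Q" unfolding Q_def by (rule prob_space.prob_space_distr) simp
    then have Q: "real_distribution Q"
      by (simp add: real_distribution_def real_distribution_axioms_def Q_def)
    have icw: "integrable M (\<lambda>x. (w x / m) *\<^sub>R iexp (t * Z x))" for t
      by (rule Bochner_Integration.integrable_bound[OF integrable_divide[OF iw, of m]]) (auto simp: norm_mult)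
    have icv: "integrable N (\<lambda>x. (v x / m) *\<^sub>R iexp (t * Y x))" for t
      by (rule Bochner_Integration.integrable_bound[OF integrable_divide[OF iv, of m]]) (auto simp: norm_mult)
    have cP: "char P t = (\<integral>x. (w x / m) *\<^sub>R iexp (t * Z x) \<partial>M)" for t
      unfolding char_def P_def using w m0 by (simp add: integral_distr integral_density)
    have cQ: "char Q t = (\<integral>x. (v x / m) *\<^sub>R iexp (t * Y x) \<partial>N)" for t
      unfolding char_def Q_def using v m0 by (simp add: integral_distr integral_density)
    have "char P t = char Q t" for t
    proof (rule complex_eqI)
      have "Re (char P t) = (\<integral>x. w x * cos (t * Z x + 0) \<partial>M) / m"
        unfolding cP integral_Re[OF icw, symmetric] by (simp add: Re_exp)
      also have "\<dots> = Re (char Q t)"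
        unfolding cQ eq integral_Re[OF icv, symmetric] by (simp add: Re_exp)
      finally show "Re (char P t) = Re (char Q t)" .
      \<comment> \<open>The phase \<open>- pi/2\<close> turns the cosine into a sine, so cosines
        with arbitrary phase control both parts of the characteristic function.\<close>
      have "Im (char P t) = (\<integral>x. w x * cos (t * Z x + (- pi/2)) \<partial>M) / m"
        unfolding cP integral_Im[OF icw, symmetric] by (simp add: Im_exp cos_diff)
      also have "\<dots> = Im (char Q t)"
        unfolding cQ eq integral_Im[OF icv, symmetric] by (simp add: Im_exp cos_diff)
      finally show "Im (char P t) = Im (char Q t)" .
    qed
    then have "P = Q" by (intro Levy_uniqueness P Q ext)
    moreover have "(\<integral>x. indicator A x \<partial>P) = (\<integral>x. w x * indicator A (Z x) \<partial>M) / m"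
      unfolding P_def using w m0 by (subst integral_distr) (simp_all add: integral_density)
    moreover have "(\<integral>x. indicator A x \<partial>Q) = (\<integral>x. v x * indicator A (Y x) \<partial>N) / m"
      unfolding Q_def using v m0 by (subst integral_distr) (simp_all add: integral_density)
    ultimately show ?thesis using mp by simp
  qed
qed

text \<open>One coordinate at a time: the weight \<open>\<Prod>j\<in>J. indicator (A j) (X x j) * (1 + cos (c \<bullet> X x + s))\<close> is
  nonnegative, so the one-dimensional uniqueness theorem applies to it and the next coordinate.\<close>

lemma prod_indicator_cos_eqI:
  fixes M :: "'a measure" and N :: "'b measure" and X :: "'a \<Rightarrow> 'i \<Rightarrow> real" and Y :: "'b \<Rightarrow> 'i \<Rightarrow> real"
  assumes M: "prob_space M" and N: "prob_space N"
    and X[measurable]: "\<And>i. (\<lambda>x. X x i) \<in> borel_measurable M"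
    and Y[measurable]: "\<And>i. (\<lambda>x. Y x i) \<in> borel_measurable N"
    and eq: "\<And>S c s. finite S \<Longrightarrow>
      (\<integral>x. cos ((\<Sum>i\<in>S. c i * X x i) + s) \<partial>M) = (\<integral>x. cos ((\<Sum>i\<in>S. c i * Y x i) + s) \<partial>N)"
    and J: "finite J" and A: "\<And>i. i \<in> J \<Longrightarrow> A i \<in> sets borel" and S: "finite S"
  shows "(\<integral>x. (\<Prod>j\<in>J. indicator (A j) (X x j)) * cos ((\<Sum>i\<in>S. c i * X x i) + s) \<partial>M) =
         (\<integral>x. (\<Prod>j\<in>J. indicator (A j) (Y x j)) * cos ((\<Sum>i\<in>S. c i * Y x i) + s) \<partial>N)"
  using J A S
proof (induction J arbitrary: S c s rule: finite_induct)
  case empty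
  then show ?case using eq by simp
next
  case (insert k J)
  interpret M: prob_space M by fact
  interpret N: prob_space N by fact
  have A[measurable]: "A i \<in> sets borel" if "i = k \<or> i \<in> J" for i using insert.prems that by auto
  define a :: "('i \<Rightarrow> real) \<Rightarrow> real" where "a = (\<lambda>x. \<Prod>j\<in>J. indicator (A j) (x j))"
  define L where "L S c x = (\<Sum>i\<in>S. c i * x i)" for S and c x :: "'i \<Rightarrow> real"
  have a01: "0 \<le> a x" "a x \<le> 1" for x
    by (auto simp: a_def indicator_def intro!: prod_nonneg prod_le_1)
  have aM[measurable]: "(\<lambda>x. a (X x)) \<in> borel_measurable M"
    unfolding a_def by (intro borel_measurable_prod) measurable
  have aN[measurable]: "(\<lambda>x. a (Y x)) \<in> borel_measurable N"
    unfolding a_def by (intro borel_measurable_prod) measurable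
  have LM[measurable]: "(\<lambda>x. L S c (X x)) \<in> borel_measurable M" for S c unfolding L_def by measurable
  have LN[measurable]: "(\<lambda>x. L S c (Y x)) \<in> borel_measurable N" for S c unfolding L_def by measurable
  have IH: "(\<integral>x. a (X x) * cos (L S c (X x) + s) \<partial>M) = (\<integral>x. a (Y x) * cos (L S c (Y x) + s) \<partial>N)"
    if "finite S" for S c s
    unfolding a_def L_def by (rule insert.IH) (use that A in auto)
  have bM: "integrable M (\<lambda>x. a (X x) * g x)" if "g \<in> borel_measurable M" "\<And>x. \<bar>g x\<bar> \<le> 1" for g
    using that a01 by (intro M.integrable_const_bound[where B=1]) (auto simp: abs_mult intro!: mult_le_one)
  have bN: "integrable N (\<lambda>x. a (Y x) * g x)" if "g \<in> borel_measurable N" "\<And>x. \<bar>g x\<bar> \<le> 1" for g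
    using that a01 by (intro N.integrable_const_bound[where B=1]) (auto simp: abs_mult intro!: mult_le_one)
  \<comment> \<open>The induction hypothesis speaks of a single linear form, so a frequency
    \<open>t\<close> on coordinate \<open>k\<close> is absorbed into it; it is added to the
    coefficient that \<open>k\<close> may already have in \<open>S\<close>.\<close>
  have upd: "\<exists>S' c'. finite S' \<and> (\<forall>x. L S' c' x = L S c x + t * x k)" if "finite S" for S c t
  proof (intro exI conjI allI)
    show "finite (insert k S)" using that by simp
    show "L (insert k S) (\<lambda>i. (if i \<in> S then c i else 0) + (if i = k then t else 0)) x = L S c x + t * x k" for x
    proof -
      have "(\<Sum>i\<in>insert k S. (if i \<in> S then c i else 0) * x i) = (\<Sum>i\<in>S. c i * x i)"
        using that by (intro sum.mono_neutral_cong_right) auto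
      moreover have "(\<Sum>i\<in>insert k S. (if i = k then t else 0) * x i) = t * x k"
        using that by (subst sum.mono_neutral_cong_right[of _ "{k}" _ "\<lambda>i. t * x i"]) auto
      ultimately show ?thesis unfolding L_def distrib_right sum.distrib by simp
    qed
  qed
  have step: "(\<integral>x. a (X x) * (1 + cos (L S c (X x) + s)) * indicator (A k) (X x k) \<partial>M) =
        (\<integral>x. a (Y x) * (1 + cos (L S c (Y x) + s)) * indicator (A k) (Y x k) \<partial>N)" if S: "finite S" for S c s
  proof (rule weighted_distr_eqI[OF M N, where C=2])
    fix t r :: real
    obtain S1 c1 where 1: "finite S1" "\<And>x. L S1 c1 x = L S c x + t * x k" using upd[OF S] by metis
    obtain S2 c2 where 2: "finite S2" "\<And>x. L S2 c2 x = L S c x + (-t) * x k" using upd[OF S] by metis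
    obtain S3 c3 where 3: "finite S3" "\<And>x. L S3 c3 x = L {} c x + t * x k" using upd[of "{}", OF finite.emptyI] by metis
    \<comment> \<open>Product-to-sum formula: each of the three terms has the shape treated by the
      induction hypothesis.\<close>
    have split: "a x * (1 + cos (L S c x + s)) * cos (t * x k + r) =
        a x * cos (L S3 c3 x + r) + (1/2) * (a x * cos (L S2 c2 x + (s - r))) + (1/2) * (a x * cos (L S1 c1 x + (s + r)))" for x
    proof -
      have "cos (L S c x + s) * cos (t * x k + r) = (cos (L S2 c2 x + (s - r)) + cos (L S1 c1 x + (s + r))) / 2"
        by (subst cos_times_cos) (simp add: 1 2 algebra_simps)
      moreover have "L S3 c3 x = t * x k" unfolding 3 by (simp add: L_def)
      moreover have "a x * (1 + cos (L S c x + s)) * cos (t * x k + r) =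
          a x * cos (t * x k + r) + a x * (cos (L S c x + s) * cos (t * x k + r))"
        by (simp add: algebra_simps)
      ultimately show ?thesis by (simp add: add_divide_distrib distrib_left)
    qed
    show "(\<integral>x. a (X x) * (1 + cos (L S c (X x) + s)) * cos (t * X x k + r) \<partial>M) =
      (\<integral>x. a (Y x) * (1 + cos (L S c (Y x) + s)) * cos (t * Y x k + r) \<partial>N)"
      unfolding split
      by (simp add: Bochner_Integration.integral_add bM bN IH 1(1) 2(1) 3(1) del: mult_cancel_left)
  next
    fix x
    show "0 \<le> a (X x) * (1 + cos (L S c (X x) + s))"
      using a01[of "X x"] cos_ge_minus_one[of "L S c (X x) + s"] by (intro mult_nonneg_nonneg) linarith+
    show "a (X x) * (1 + cos (L S c (X x) + s)) \<le> 2"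
      using mult_mono[OF a01(2)[of "X x"], of "1 + cos (L S c (X x) + s)" 2] cos_le_one[of "L S c (X x) + s"] 
        cos_ge_minus_one[of "L S c (X x) + s"] by linarith
  next
    fix x
    show "0 \<le> a (Y x) * (1 + cos (L S c (Y x) + s))"
      using a01[of "Y x"] cos_ge_minus_one[of "L S c (Y x) + s"] by (intro mult_nonneg_nonneg) linarith+
    show "a (Y x) * (1 + cos (L S c (Y x) + s)) \<le> 2"
      using mult_mono[OF a01(2)[of "Y x"], of "1 + cos (L S c (Y x) + s)" 2] cos_le_one[of "L S c (Y x) + s"] 
        cos_ge_minus_one[of "L S c (Y x) + s"] by linarith
  qed (use A in \<open>auto intro!: borel_measurable_times\<close>)
  have "L {} c x = 0" for c x by (simp add: L_def)
  \<comment> \<open>With the empty form and phase \<open>pi/2\<close> the cosine vanishes and the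
    weight is \<open>a\<close> alone. Subtracting this from \<open>step\<close> removes the summand
    \<open>1\<close>, which was there to make the weight nonnegative.\<close>
  then have base: "(\<integral>x. a (X x) * indicator (A k) (X x k) \<partial>M) = (\<integral>x. a (Y x) * indicator (A k) (Y x k) \<partial>N)"
    using step[of "{}" undefined "pi/2"] by simp
  have iM: "integrable M (\<lambda>x. a (X x) * indicator (A k) (X x k))"
    "integrable M (\<lambda>x. a (X x) * (indicator (A k) (X x k) * cos (L S c (X x) + s)))" for S c s
    using A[of k] by (auto intro!: bM simp: indicator_def)
  have iN: "integrable N (\<lambda>x. a (Y x) * indicator (A k) (Y x k))"
    "integrable N (\<lambda>x. a (Y x) * (indicator (A k) (Y x k) * cos (L S c (Y x) + s)))" for S c s
    using A[of k] by (auto intro!: bN simp: indicator_def)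
  have sp: "a x * (1 + z) * i = a x * i + a x * (i * z)" for x z i by (simp add: algebra_simps)
  have "(\<integral>x. a (X x) * (indicator (A k) (X x k) * cos (L S c (X x) + s)) \<partial>M) =
     (\<integral>x. a (Y x) * (indicator (A k) (Y x k) * cos (L S c (Y x) + s)) \<partial>N)"
    using step[OF insert.prems(2), of c s] base
    unfolding sp Bochner_Integration.integral_add[OF iM] Bochner_Integration.integral_add[OF iN] by simp
  then show ?case
    using insert.hyps by (simp add: a_def L_def mult_ac)
qed

text \<open>The Cramer-Wold device. Since the index type is countable, the Borel sets of the product
  are generated by finite-dimensional rectangles, and these are compared by
  \<open>prod_indicator_cos_eqI\<close> with a trivial cosine factor.\<close>

theorem distr_eqI_linear_combinations:
  fixes M :: "'a measure" and N :: "'b measure"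
    and X :: "'a \<Rightarrow> 'i::countable \<Rightarrow> real" and Y :: "'b \<Rightarrow> 'i \<Rightarrow> real"
  assumes M: "prob_space M" and N: "prob_space N"
    and X[measurable]: "\<And>i. (\<lambda>x. X x i) \<in> borel_measurable M"
    and Y[measurable]: "\<And>i. (\<lambda>x. Y x i) \<in> borel_measurable N"
    and eq: "\<And>S c. finite S \<Longrightarrow>
      (\<integral>x. iexp (\<Sum>i\<in>S. c i * X x i) \<partial>M) = (\<integral>x. iexp (\<Sum>i\<in>S. c i * Y x i) \<partial>N)"
  shows "distr M borel X = distr N borel Y"
proof -
  interpret M: prob_space M by fact
  interpret N: prob_space N by fact
  have XX[measurable]: "X \<in> borel_measurable M" "Y \<in> borel_measurable N"
    using X Y by (auto intro!: measurable_coordinatewise_then_product)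
  have c: "(\<integral>x. cos ((\<Sum>i\<in>S. c i * X x i) + s) \<partial>M) = (\<integral>x. cos ((\<Sum>i\<in>S. c i * Y x i) + s) \<partial>N)"
    if "finite S" for S c and s :: real
  proof -
    have r: "cos (z + s) = Re (iexp z * iexp s)" for z
      by (simp add: exp_add[symmetric] distrib_left[symmetric] Re_exp flip: of_real_add)
    have i: "integrable M (\<lambda>x. iexp (\<Sum>i\<in>S. c i * X x i) * iexp s)" "integrable N (\<lambda>x. iexp (\<Sum>i\<in>S. c i * Y x i) * iexp s)"
      by (auto intro!: M.integrable_const_bound[where B=1] N.integrable_const_bound[where B=1] simp: norm_mult)
    show ?thesis unfolding r integral_Re[OF i(1)] integral_Re[OF i(2)]
      by (simp only: integral_mult_left_zero eq[OF that])
  qed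
  show ?thesis
  proof (rule measure_eqI_PiM_infinite[where I = UNIV and M = "\<lambda>_. borel"])
    show "sets (distr M borel X) = sets (Pi\<^sub>M UNIV (\<lambda>_. borel))" "sets (distr N borel Y) = sets (Pi\<^sub>M UNIV (\<lambda>_. borel))"
      by (simp_all add: sets_PiM_equal_borel)
    show "finite_measure (distr M borel X)"
      by (intro prob_space.finite_measure M.prob_space_distr) simp
    fix A :: "'i \<Rightarrow> real set" and J :: "'i set"
    assume J: "finite J" and A: "\<And>i. i \<in> J \<Longrightarrow> A i \<in> sets borel"
    let ?E = "prod_emb UNIV (\<lambda>_. borel :: real measure) J (Pi\<^sub>E J A)"
    have E: "?E = {x. \<forall>j\<in>J. x j \<in> A j}"
      by (auto simp: prod_emb_def PiE_iff)
    have "?E \<in> sets (Pi\<^sub>M UNIV (\<lambda>_. borel))"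
      using J A by (intro sets_PiM_I) auto
    then have Es[measurable]: "?E \<in> sets borel" by (simp add: sets_PiM_equal_borel)
    have ind: "indicator ?E x = (\<Prod>j\<in>J. indicator (A j) (x j) :: real)" for x
      using J by (auto simp: E indicator_def)
    have "(\<integral>x. indicator ?E (X x) \<partial>M) = (\<integral>x. indicator ?E (Y x) \<partial>N :: real)"
      unfolding ind using prod_indicator_cos_eqI[OF M N X Y c J A, where S = "{}" and s = 0] by simp
    moreover have "(\<integral>x. indicator ?E (X x) \<partial>M) = measure (distr M borel X) ?E"
      by (subst Bochner_Integration.integral_cong[OF refl, of M _ "indicator (X -` ?E \<inter> space M)"])
        (auto simp: measure_distr indicator_def)
    moreover have "(\<integral>x. indicator ?E (Y x) \<partial>N) = measure (distr N borel Y) ?E"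
      by (subst Bochner_Integration.integral_cong[OF refl, of N _ "indicator (Y -` ?E \<inter> space N)"])
        (auto simp: measure_distr indicator_def)
    ultimately have "measure (distr M borel X) ?E = measure (distr N borel Y) ?E"
      by simp
    then show "emeasure (distr M borel X) ?E = emeasure (distr N borel Y) ?E"
      using prob_space.finite_measure[OF M.prob_space_distr[OF XX(1)]] prob_space.finite_measure[OF N.prob_space_distr[OF XX(2)]]
      by (simp add: finite_measure.emeasure_eq_measure)
  qed
qed


section \<open>Averages and mollification of Lipschitz functions\<close>

text \<open>Vectors of dimension \<open>n\<close> are encoded as infinite sequences, so that one
  type serves all dimensions; the inequality forces \<open>f\<close> to ignore the coordinates from
  \<open>n\<close> on.\<close>

definition l1_lipschitz :: "nat \<Rightarrow> real \<Rightarrow> ((nat \<Rightarrow> real) \<Rightarrow> real) \<Rightarrow> bool" where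
  "l1_lipschitz n L f \<longleftrightarrow> (\<forall>x y. \<bar>f x - f y\<bar> \<le> L * (\<Sum>i<n. \<bar>x i - y i\<bar>))"

text \<open>A quantitative form of "\<open>p\<close> is the partial derivative of \<open>f\<close>
  in direction \<open>i\<close>". Being made of inequalities, it survives averaging by mere
  integration, with no differentiation under the integral. The lower bound \<open>0\<close> is what
  monotonicity contributes.\<close>

definition partial_taylor ::
    "nat \<Rightarrow> real \<Rightarrow> real \<Rightarrow> ((nat \<Rightarrow> real) \<Rightarrow> real) \<Rightarrow> nat \<Rightarrow> ((nat \<Rightarrow> real) \<Rightarrow> real) \<Rightarrow> bool" where
  "partial_taylor n L K f i p \<longleftrightarrow>
     l1_lipschitz n K p \<and> (\<forall>x. 0 \<le> p x \<and> p x \<le> L) \<and>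
     (\<forall>x t. \<bar>f (x(i := x i + t)) - f x - p x * t\<bar> \<le> K * t\<^sup>2)"

definition bounded_mono_lipschitz :: "nat \<Rightarrow> real \<Rightarrow> real \<Rightarrow> ((nat \<Rightarrow> real) \<Rightarrow> real) \<Rightarrow> bool" where
  "bounded_mono_lipschitz n b L f \<longleftrightarrow> (\<forall>x. \<bar>f x\<bar> \<le> b) \<and> mono f \<and> l1_lipschitz n L f"

text \<open>A convolution operator with two uses: a shift uniform in one coordinate mollifies, and
  scaled copies of a Gaussian vector give a Markov semigroup.\<close>

definition average :: "'a measure \<Rightarrow> ('a \<Rightarrow> nat \<Rightarrow> real) \<Rightarrow> ((nat \<Rightarrow> real) \<Rightarrow> real) \<Rightarrow> (nat \<Rightarrow> real) \<Rightarrow> real" where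
  "average \<mu> v f x = (\<integral>\<omega>. f (\<lambda>i. x i + v \<omega> i) \<partial>\<mu>)"

lemma l1_lipschitzD: "l1_lipschitz n L f \<Longrightarrow> \<bar>f x - f y\<bar> \<le> L * (\<Sum>i<n. \<bar>x i - y i\<bar>)"
  by (simp add: l1_lipschitz_def)

lemma l1_lipschitz_cong:
  "l1_lipschitz n L f \<Longrightarrow> (\<And>i. i < n \<Longrightarrow> x i = y i) \<Longrightarrow> f x = f y"
  using l1_lipschitzD[of n L f x y] by simp

lemma l1_lipschitz_measurable:
  assumes "l1_lipschitz n L f"
  shows "f \<in> borel_measurable borel"
proof -
  have "isCont f x" for x
  proof -
    have "((\<lambda>y. y i) \<longlongrightarrow> x i) (at x)" for i
      using continuous_on_product_then_coordinatewise[OF continuous_on_id, of UNIV i]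
      by (metis UNIV_I continuous_on_eq_continuous_at isCont_def open_UNIV)
    then have "((\<lambda>y. L * (\<Sum>i<n. \<bar>y i - x i\<bar>)) \<longlongrightarrow> L * (\<Sum>i<n. \<bar>x i - x i\<bar>)) (at x)"
      by (intro tendsto_mult tendsto_const tendsto_sum tendsto_rabs tendsto_diff)
    then have "((\<lambda>y. f y - f x) \<longlongrightarrow> 0) (at x)"
      by (intro Lim_null_comparison[where f = "\<lambda>y. f y - f x" and g = "\<lambda>y. L * (\<Sum>i<n. \<bar>y i - x i\<bar>)"])
        (use l1_lipschitzD[OF assms] in auto)
    then show ?thesis
      unfolding isCont_def by (rule LIM_zero_cancel)
  qed
  then show ?thesis
    by (intro borel_measurable_continuous_onI continuous_at_imp_continuous_on) auto
qed

lemma l1_lipschitz_mult: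
  assumes f: "l1_lipschitz n L f" "\<And>x. \<bar>f x\<bar> \<le> b" and g: "l1_lipschitz n L g" "\<And>x. \<bar>g x\<bar> \<le> b"
  shows "l1_lipschitz n (2 * b * L) (\<lambda>x. f x * g x)"
  unfolding l1_lipschitz_def
proof (intro allI)
  fix x y :: "nat \<Rightarrow> real"
  let ?d = "\<Sum>i<n. \<bar>x i - y i\<bar>"
  have "f x * g x - f y * g y = f x * (g x - g y) + g y * (f x - f y)"
    by (simp add: algebra_simps)
  also have "\<bar>\<dots>\<bar> \<le> \<bar>f x\<bar> * \<bar>g x - g y\<bar> + \<bar>g y\<bar> * \<bar>f x - f y\<bar>"
    by (metis abs_mult abs_triangle_ineq)
  also have "\<dots> \<le> b * (L * ?d) + b * (L * ?d)"
    by (intro add_mono mult_mono f g l1_lipschitzD) (use f(2) in \<open>auto intro: order_trans[OF abs_ge_zero]\<close>)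
  finally show "\<bar>f x * g x - f y * g y\<bar> \<le> 2 * b * L * ?d"
    by (simp add: mult_ac)
qed

section \<open>Stability of the function classes under averaging\<close>

context prob_space
begin

lemma shift_measurable:
  fixes v :: "'a \<Rightarrow> nat \<Rightarrow> real" and f :: "(nat \<Rightarrow> real) \<Rightarrow> real"
  assumes v[measurable]: "v \<in> borel_measurable M"
    and f[measurable]: "f \<in> borel_measurable borel"
  shows "(\<lambda>\<omega>. f (\<lambda>i. x i + v \<omega> i)) \<in> borel_measurable M"
proof -
  have [measurable]: "(\<lambda>\<omega>. v \<omega> i) \<in> borel_measurable M" for i
    by (rule measurable_product_then_coordinatewise[OF v])
  have [measurable]: "(\<lambda>\<omega>. (\<lambda>i. x i + v \<omega> i)) \<in> borel_measurable M"
    by (rule measurable_coordinatewise_then_product) measurable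
  show ?thesis by measurable
qed

lemma shift_integrable:
  fixes v :: "'a \<Rightarrow> nat \<Rightarrow> real" and f :: "(nat \<Rightarrow> real) \<Rightarrow> real"
  assumes v: "v \<in> borel_measurable M"
    and f: "f \<in> borel_measurable borel" "\<And>x. \<bar>f x\<bar> \<le> b"
  shows "integrable M (\<lambda>\<omega>. f (\<lambda>i. x i + v \<omega> i))"
  by (rule integrable_const_bound[where B=b]) (use f(2) in \<open>auto intro: shift_measurable v f(1)\<close>)

lemma abs_integral_le:
  assumes "integrable M f" "\<And>x. \<bar>f x\<bar> \<le> (c::real)"
  shows "\<bar>\<integral>x. f x \<partial>M\<bar> \<le> c"
proof -
  have "\<bar>\<integral>x. f x \<partial>M\<bar> \<le> (\<integral>x. \<bar>f x\<bar> \<partial>M)" by (rule integral_abs_bound)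
  also have "\<dots> \<le> (\<integral>x. c \<partial>M)" by (intro integral_mono integrable_abs assms) auto
  finally show ?thesis by (simp add: prob_space)
qed

lemma average_bounded:
  assumes v: "v \<in> borel_measurable M"
    and f: "f \<in> borel_measurable borel" "\<And>x. \<bar>f x\<bar> \<le> b"
  shows "\<bar>average M v f x\<bar> \<le> b"
  unfolding average_def by (rule abs_integral_le) (use assms in \<open>auto intro: shift_integrable\<close>)

lemma average_lipschitz:
  assumes v: "v \<in> borel_measurable M"
    and f: "l1_lipschitz n L f" "\<And>x. \<bar>f x\<bar> \<le> b"
  shows "l1_lipschitz n L (average M v f)"
  unfolding l1_lipschitz_def
proof (intro allI)
  fix x y :: "nat \<Rightarrow> real"
  note i = shift_integrable[OF v l1_lipschitz_measurable[OF f(1)] f(2)]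
  have "average M v f x - average M v f y = (\<integral>\<omega>. f (\<lambda>i. x i + v \<omega> i) - f (\<lambda>i. y i + v \<omega> i) \<partial>M)"
    unfolding average_def by (intro Bochner_Integration.integral_diff[symmetric] i)
  also have "\<bar>\<dots>\<bar> \<le> L * (\<Sum>i<n. \<bar>x i - y i\<bar>)"
  proof (intro abs_integral_le Bochner_Integration.integrable_diff i)
    show "\<bar>f (\<lambda>i. x i + v \<omega> i) - f (\<lambda>i. y i + v \<omega> i)\<bar> \<le> L * (\<Sum>i<n. \<bar>x i - y i\<bar>)" for \<omega>
      using l1_lipschitzD[OF f(1), of "\<lambda>i. x i + v \<omega> i" "\<lambda>i. y i + v \<omega> i"] by simp
  qed
  finally show "\<bar>average M v f x - average M v f y\<bar> \<le> L * (\<Sum>i<n. \<bar>x i - y i\<bar>)" .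
qed

lemma average_bounded_mono_lipschitz:
  assumes v: "v \<in> borel_measurable M"
    and f: "bounded_mono_lipschitz n b L f"
  shows "bounded_mono_lipschitz n b L (average M v f)"
proof -
  have b: "\<And>x. \<bar>f x\<bar> \<le> b" and m: "mono f" and l: "l1_lipschitz n L f"
    using f by (auto simp: bounded_mono_lipschitz_def)
  note fm = l1_lipschitz_measurable[OF l]
  have "mono (average M v f)"
    unfolding average_def
    by (intro monoI integral_mono shift_integrable[OF v fm b] monoD[OF m]) (auto simp: le_fun_def)
  then show ?thesis
    unfolding bounded_mono_lipschitz_def using average_bounded[OF v fm b] average_lipschitz[OF v l b] by blast
qed

lemma average_partial_taylor:
  assumes v: "v \<in> borel_measurable M"
    and f: "l1_lipschitz n L f" "\<And>x. \<bar>f x\<bar> \<le> b" and p: "partial_taylor n L' K f i p"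
  shows "partial_taylor n L' K (average M v f) i (average M v p)"
proof -
  have pl: "l1_lipschitz n K p" and p0: "\<And>x. 0 \<le> p x" and pL: "\<And>x. p x \<le> L'"
    and t: "\<And>x t. \<bar>f (x(i := x i + t)) - f x - p x * t\<bar> \<le> K * t\<^sup>2"
    using p by (auto simp: partial_taylor_def)
  have pb: "\<bar>p x\<bar> \<le> L'" for x using p0[of x] pL[of x] by simp
  note fi = shift_integrable[OF v l1_lipschitz_measurable[OF f(1)] f(2)]
  note pi = shift_integrable[OF v l1_lipschitz_measurable[OF pl] pb]
  have 1: "l1_lipschitz n K (average M v p)" by (rule average_lipschitz[OF v pl pb])
  have 2: "0 \<le> average M v p x" "average M v p x \<le> L'" for x
    unfolding average_def using p0 integral_le_const[OF pi] pL by (auto intro!: integral_nonneg_AE)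
  have 3: "\<bar>average M v f (x(i := x i + t)) - average M v f x - average M v p x * t\<bar> \<le> K * t\<^sup>2" for x t
  proof -
    let ?y = "\<lambda>\<omega> j. x j + v \<omega> j"
    have sh: "(\<lambda>j. (x(i := x i + t)) j + v \<omega> j) = (?y \<omega>)(i := ?y \<omega> i + t)" for \<omega> by auto
    have i1: "integrable M (\<lambda>\<omega>. f ((?y \<omega>)(i := ?y \<omega> i + t)))"
      using fi[of "x(i := x i + t)"] unfolding sh .
    have "average M v f (x(i := x i + t)) - average M v f x - average M v p x * t =
        (\<integral>\<omega>. f ((?y \<omega>)(i := ?y \<omega> i + t)) - f (?y \<omega>) - p (?y \<omega>) * t \<partial>M)"
      unfolding average_def sh
      by (simp add: i1 fi pi integrable_diff)
    also have "\<bar>\<dots>\<bar> \<le> K * t\<^sup>2"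
      by (intro abs_integral_le Bochner_Integration.integrable_diff i1 fi integrable_mult_left pi t)
    finally show ?thesis .
  qed
  show ?thesis unfolding partial_taylor_def using 1 2 3 by blast
qed

end

text \<open>Coordinates are moved one at a time, \<open>z k\<close> having the first
  \<open>k\<close> moved. Moving coordinate \<open>m\<close> costs one error from the expansion at
  \<open>z m\<close> and one from replacing \<open>p m (z m)\<close> by \<open>p m x\<close>; each
  is at most \<open>K * N * \<bar>y m\<bar>\<close>, hence the factor 2.\<close>

lemma taylor_of_partials:
  assumes f: "l1_lipschitz n L f" and p: "\<And>i. i < n \<Longrightarrow> partial_taylor n L' K f i (p i)" and K: "K \<ge> 0"
  shows "\<bar>f (\<lambda>i. x i + y i) - f x - (\<Sum>i<n. p i x * y i)\<bar> \<le> 2 * K * (\<Sum>i<n. \<bar>y i\<bar>)\<^sup>2"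
proof -
  define N where "N = (\<Sum>i<n. \<bar>y i\<bar>)"
  define z where "z k = (\<lambda>i. if i < k then x i + y i else x i)" for k :: nat
  have *: "m \<le> n \<Longrightarrow> \<bar>f (z m) - f x - (\<Sum>i<m. p i x * y i)\<bar> \<le> 2 * K * N * (\<Sum>i<m. \<bar>y i\<bar>)" for m
  proof (induction m)
    case 0
    have "z 0 = x" by (auto simp: z_def)
    then show ?case by simp
  next
    case (Suc m)
    have zS: "z (Suc m) = (z m)(m := z m m + y m)" by (auto simp: z_def less_Suc_eq)
    have yN: "\<bar>y m\<bar> \<le> N" unfolding N_def using Suc.prems by (intro member_le_sum) auto
    have 1: "\<bar>f (z (Suc m)) - f (z m) - p m (z m) * y m\<bar> \<le> K * (y m)\<^sup>2"
      unfolding zS using p[of m] Suc.prems by (simp add: partial_taylor_def)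
    have "(y m)\<^sup>2 \<le> N * \<bar>y m\<bar>"
      using mult_right_mono[OF yN abs_ge_zero[of "y m"]] by (simp add: power2_eq_square)
    from mult_left_mono[OF this K] have 2: "K * (y m)\<^sup>2 \<le> K * N * \<bar>y m\<bar>"
      by (simp add: mult.assoc)
    have "\<bar>p m (z m) - p m x\<bar> \<le> K * (\<Sum>i<n. \<bar>z m i - x i\<bar>)"
      using p[of m] Suc.prems by (intro l1_lipschitzD) (simp add: partial_taylor_def)
    also have "\<dots> \<le> K * N"
      unfolding N_def by (intro mult_left_mono sum_mono K) (auto simp: z_def)
    finally have "\<bar>(p m (z m) - p m x) * y m\<bar> \<le> K * N * \<bar>y m\<bar>"
      by (simp add: abs_mult mult_right_mono)
    then have "\<bar>p m (z m) * y m - p m x * y m\<bar> \<le> K * N * \<bar>y m\<bar>"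
      by (simp add: left_diff_distrib)
    with 1 2 have "\<bar>f (z (Suc m)) - f (z m) - p m x * y m\<bar> \<le> 2 * K * N * \<bar>y m\<bar>"
      by linarith
    then show ?case using Suc by (simp only: sum.lessThan_Suc distrib_left) linarith
  qed
  have "f (\<lambda>i. x i + y i) = f (z n)" by (rule l1_lipschitz_cong[OF f]) (simp add: z_def)
  then show ?thesis using *[of n] by (simp add: N_def power2_eq_square mult.assoc)
qed

text \<open>With an antiderivative \<open>G\<close> of \<open>g\<close>, the averaged function is \<open>\<psi> r = (G (r + \<epsilon>) - G r) / \<epsilon>\<close>.\<close>

lemma moving_average_taylor:
  fixes g :: "real \<Rightarrow> real"
  assumes g: "\<And>r s. \<bar>g r - g s\<bar> \<le> L * \<bar>r - s\<bar>" and \<epsilon>: "\<epsilon> > 0"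
  defines "\<psi> \<equiv> \<lambda>r. \<integral>s. g (r + \<epsilon> * s) \<partial>restrict_space lborel {0..1}"
  shows "\<bar>\<psi> t - \<psi> 0 - (g \<epsilon> - g 0) / \<epsilon> * t\<bar> \<le> 2 * L / \<epsilon> * t\<^sup>2"
proof -
  have cont: "isCont g x" for x
  proof -
    have "((\<lambda>y. L * \<bar>y - x\<bar>) \<longlongrightarrow> L * \<bar>x - x\<bar>) (at x)" by (intro tendsto_intros)
    then have "((\<lambda>y. g y - g x) \<longlongrightarrow> 0) (at x)"
      by (intro Lim_null_comparison[where f = "\<lambda>y. g y - g x" and g = "\<lambda>y. L * \<bar>y - x\<bar>"]) (use g in auto)
    then show ?thesis unfolding isCont_def by (rule LIM_zero_cancel)
  qed
  obtain G where G: "(G has_real_derivative g x) (at x)" for x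
    using einterval_antiderivative[of "-\<infinity>" \<infinity> g] cont
    by (auto simp: has_real_derivative_iff_has_vector_derivative)
  have psi: "\<psi> r = (G (r + \<epsilon>) - G r) / \<epsilon>" for r
  proof -
    have "\<psi> r = (\<integral>s. g (r + \<epsilon> * s) * indicator {0..1} s \<partial>lborel)"
      unfolding \<psi>_def by (simp add: integral_restrict_space mult.commute)
    also have "\<dots> = G (r + \<epsilon> * 1) / \<epsilon> - G (r + \<epsilon> * 0) / \<epsilon>"
    proof (rule integral_FTC_Icc_real)
      fix s :: real
      show "((\<lambda>s. G (r + \<epsilon> * s) / \<epsilon>) has_real_derivative g (r + \<epsilon> * s)) (at s)"
        using \<epsilon> by (auto intro!: derivative_eq_intros DERIV_chain2[OF G])
      show "isCont (\<lambda>s. g (r + \<epsilon> * s)) s"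
        by (intro isCont_o2[OF _ cont] continuous_intros)
    qed simp
    finally show ?thesis by (simp add: diff_divide_distrib)
  qed
  define q where "q r = (g (r + \<epsilon>) - g r) / \<epsilon>" for r
  define h where "h r = \<psi> r - q 0 * r" for r
  have hG: "h = (\<lambda>r. (G (r + \<epsilon>) - G r) / \<epsilon> - q 0 * r)"
    by (simp add: fun_eq_iff h_def psi)
  \<comment> \<open>Mean value inequality for \<open>\<psi>\<close> minus its tangent line at 0: the
    derivative \<open>q r - q 0\<close> is small because \<open>g\<close> is Lipschitz at both ends
    of the averaging window.\<close>
  have "norm (h t - h 0) \<le> (2 * L / \<epsilon> * \<bar>t\<bar>) * norm (t - 0)"
  proof (rule field_differentiable_bound[of "{-\<bar>t\<bar>..\<bar>t\<bar>}" h "\<lambda>r. q r - q 0"])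
    fix r assume r: "r \<in> {-\<bar>t\<bar>..\<bar>t\<bar>}"
    have "((\<lambda>r. G (r + \<epsilon>)) has_real_derivative g (r + \<epsilon>)) (at r)"
      using G[of "r + \<epsilon>"] by (simp add: DERIV_shift)
    then have "((\<lambda>r. (G (r + \<epsilon>) - G r) / \<epsilon> - q 0 * r) has_real_derivative (g (r + \<epsilon>) - g r) / \<epsilon> - q 0 * 1) (at r)"
      by (intro DERIV_diff DERIV_cdivide DERIV_cmult G DERIV_ident)
    then have "(h has_real_derivative q r - q 0 * 1) (at r)"
      unfolding hG q_def[of r] .
    then show "(h has_field_derivative q r - q 0) (at r within {-\<bar>t\<bar>..\<bar>t\<bar>})"
      unfolding mult_1_right by (rule has_field_derivative_at_within)
    have "L \<ge> 0" using g[of 1 0] by (simp add: order_trans[OF abs_ge_zero])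
    have "\<bar>(g (r + \<epsilon>) - g \<epsilon>) - (g r - g 0)\<bar> \<le> 2 * L * \<bar>r\<bar>"
      using g[of "r + \<epsilon>" \<epsilon>] g[of r 0] by (simp; linarith)
    also have "\<dots> \<le> 2 * L * \<bar>t\<bar>" using r \<open>L \<ge> 0\<close> by (intro mult_left_mono) auto
    finally have "\<bar>(g (r + \<epsilon>) - g \<epsilon>) - (g r - g 0)\<bar> / \<epsilon> \<le> 2 * L * \<bar>t\<bar> / \<epsilon>"
      using \<epsilon> by (intro divide_right_mono) auto
    moreover have "q r - q 0 = ((g (r + \<epsilon>) - g \<epsilon>) - (g r - g 0)) / \<epsilon>"
      unfolding q_def by (simp add: diff_divide_distrib)
    ultimately show "norm (q r - q 0) \<le> 2 * L / \<epsilon> * \<bar>t\<bar>"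
      using \<epsilon> by (simp add: abs_divide)
  qed auto
  then show ?thesis
    by (simp add: h_def q_def power2_eq_square abs_mult_self_eq mult.assoc algebra_simps)
qed

text \<open>The coordinates are averaged in turn over windows of length \<open>\<epsilon>\<close>.
  Each round smooths one direction, keeps the smoothness already gained in the others, and moves the
  function by at most \<open>L * \<epsilon>\<close>.\<close>

lemma mollification:
  assumes f: "bounded_mono_lipschitz n b L f" and \<epsilon>: "\<epsilon> > 0"
  shows "\<exists>g. bounded_mono_lipschitz n b L g \<and>
    (\<forall>i<n. \<exists>p. partial_taylor n L (2 * L / \<epsilon>) g i p) \<and> (\<forall>x. \<bar>g x - f x\<bar> \<le> n * L * \<epsilon>)"
proof -
  let ?K = "2 * L / \<epsilon>" and ?\<mu> = "restrict_space lborel {0..1::real}"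
  interpret prob_space ?\<mu> by (rule prob_space_restrict_space) auto
  have "m \<le> n \<Longrightarrow> \<exists>g. bounded_mono_lipschitz n b L g \<and>
    (\<forall>i<m. \<exists>p. partial_taylor n L ?K g i p) \<and> (\<forall>x. \<bar>g x - f x\<bar> \<le> m * L * \<epsilon>)" for m
  proof (induction m)
    case 0
    then show ?case using f by auto
  next
    case (Suc m)
    then obtain g where g: "bounded_mono_lipschitz n b L g" "\<And>i. i < m \<Longrightarrow> \<exists>p. partial_taylor n L ?K g i p"
      "\<And>x. \<bar>g x - f x\<bar> \<le> m * L * \<epsilon>" by auto
    then have gb: "\<And>x. \<bar>g x\<bar> \<le> b" and gm: "mono g" and gl: "l1_lipschitz n L g"
      by (auto simp: bounded_mono_lipschitz_def)
    define v :: "real \<Rightarrow> nat \<Rightarrow> real" where "v s = (\<lambda>i. if i = m then \<epsilon> * s else 0)" for s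
    have "(\<lambda>s. v s i) \<in> borel_measurable ?\<mu>" for i
      unfolding v_def by (cases "i = m") (auto intro!: measurable_restrict_space1)
    then have v: "v \<in> borel_measurable ?\<mu>"
      by (rule measurable_coordinatewise_then_product)
    define h where "h = average ?\<mu> v g"
    have sh: "(\<lambda>i. x i + v s i) = x(m := x m + \<epsilon> * s)" for x s by (auto simp: v_def)
    have coord: "(\<Sum>i<n. \<bar>(x(m := a)) i - (x(m := a')) i\<bar>) = \<bar>a - a'\<bar>" for x :: "nat \<Rightarrow> real" and a a'
    proof -
      have "(\<Sum>i<n. \<bar>(x(m := a)) i - (x(m := a')) i\<bar>) = (\<Sum>i<n. if i = m then \<bar>a - a'\<bar> else 0)"
        by (intro sum.cong) auto
      then show ?thesis using Suc.prems by simp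
    qed
    have coordlip: "\<bar>g (x(m := a)) - g (x(m := a'))\<bar> \<le> L * \<bar>a - a'\<bar>" for x a a'
      using l1_lipschitzD[OF gl, of "x(m := a)" "x(m := a')"] unfolding coord .
    have L: "L \<ge> 0" using coordlip[of undefined 1 0] by (simp add: order_trans[OF abs_ge_zero])
    have hr: "bounded_mono_lipschitz n b L h"
      unfolding h_def by (rule average_bounded_mono_lipschitz[OF v g(1)])
    have hp: "\<exists>p. partial_taylor n L ?K h i p" if "i < m" for i
      unfolding h_def using average_partial_taylor[OF v gl gb] g(2)[OF that] by blast
    \<comment> \<open>The derivative of a moving average is the difference quotient of the function
      across the window: nonnegative because \<open>g\<close> is monotone, at most \<open>L\<close>
      because \<open>g\<close> is Lipschitz.\<close>
    define p where "p x = (g (x(m := x m + \<epsilon>)) - g x) / \<epsilon>" for x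
    have "partial_taylor n L ?K h m p"
      unfolding partial_taylor_def l1_lipschitz_def
    proof (intro conjI allI)
      fix x y :: "nat \<Rightarrow> real"
      have "\<bar>g (x(m := x m + \<epsilon>)) - g (y(m := y m + \<epsilon>))\<bar> \<le> L * (\<Sum>i<n. \<bar>x i - y i\<bar>)"
        by (rule order_trans[OF l1_lipschitzD[OF gl]]) (intro mult_left_mono sum_mono L; auto)
      then have "\<bar>(g (x(m := x m + \<epsilon>)) - g (y(m := y m + \<epsilon>))) - (g x - g y)\<bar> \<le> 2 * L * (\<Sum>i<n. \<bar>x i - y i\<bar>)"
        using l1_lipschitzD[OF gl, of x y] by linarith
      then have "\<bar>(g (x(m := x m + \<epsilon>)) - g (y(m := y m + \<epsilon>))) - (g x - g y)\<bar> / \<epsilon> \<le> 2 * L * (\<Sum>i<n. \<bar>x i - y i\<bar>) / \<epsilon>"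
        using \<epsilon> by (intro divide_right_mono) auto
      moreover have "p x - p y = ((g (x(m := x m + \<epsilon>)) - g (y(m := y m + \<epsilon>))) - (g x - g y)) / \<epsilon>"
        by (simp add: p_def diff_divide_distrib)
      ultimately show "\<bar>p x - p y\<bar> \<le> ?K * (\<Sum>i<n. \<bar>x i - y i\<bar>)"
        using \<epsilon> by (simp add: abs_divide)
    next
      fix x :: "nat \<Rightarrow> real"
      show "0 \<le> p x"
        unfolding p_def using \<epsilon> by (intro divide_nonneg_pos) (auto intro!: monoD[OF gm] simp: le_fun_def)
      show "p x \<le> L"
        unfolding p_def using coordlip[of x "x m + \<epsilon>" "x m"] \<epsilon> by (simp add: divide_le_eq)
    next
      fix x :: "nat \<Rightarrow> real" and t :: real
      let ?g = "\<lambda>r. g (x(m := x m + r))"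
      have gl: "\<bar>?g r - ?g s\<bar> \<le> L * \<bar>r - s\<bar>" for r s using coordlip[of x "x m + r" "x m + s"] by simp
      have e: "h (x(m := x m + r)) = (\<integral>s. ?g (r + \<epsilon> * s) \<partial>?\<mu>)" for r
      proof -
      have "(\<lambda>i. (x(m := x m + r)) i + v s i) = x(m := x m + (r + \<epsilon> * s))" for s
        by (auto simp: v_def)
      then show ?thesis unfolding h_def average_def by simp
    qed
      from e[of 0] have e0: "h x = (\<integral>s. ?g (0 + \<epsilon> * s) \<partial>?\<mu>)" by simp
      show "\<bar>h (x(m := x m + t)) - h x - p x * t\<bar> \<le> ?K * t\<^sup>2"
        using moving_average_taylor[of ?g L \<epsilon> t, OF gl \<epsilon>] unfolding e e0 p_def by simp
    qed
    then have hp': "\<exists>p. partial_taylor n L ?K h i p" if "i < Suc m" for i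
      using that hp less_Suc_eq by blast
    have "\<bar>h x - g x\<bar> \<le> L * \<epsilon>" for x
    proof -
      have i: "integrable ?\<mu> (\<lambda>s. g (x(m := x m + \<epsilon> * s)))"
        using shift_integrable[OF v l1_lipschitz_measurable[OF gl] gb, of x] unfolding sh .
      have "h x - g x = (\<integral>s. g (x(m := x m + \<epsilon> * s)) - g x \<partial>?\<mu>)"
        unfolding h_def average_def sh using prob_space by (simp add: i space_restrict_space)
      also have "\<bar>\<dots>\<bar> \<le> (\<integral>s. \<bar>g (x(m := x m + \<epsilon> * s)) - g x\<bar> \<partial>?\<mu>)" by (rule integral_abs_bound)
      also have "\<dots> \<le> L * \<epsilon>"
      proof (rule integral_le_const)
        show "AE s in ?\<mu>. \<bar>g (x(m := x m + \<epsilon> * s)) - g x\<bar> \<le> L * \<epsilon>"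
        proof (rule AE_I2)
          fix s assume "s \<in> space ?\<mu>"
          then have s: "0 \<le> s" "s \<le> 1" by (auto simp: space_restrict_space)
          have "\<bar>g (x(m := x m + \<epsilon> * s)) - g x\<bar> \<le> L * (\<epsilon> * s)"
            using coordlip[of x "x m + \<epsilon> * s" "x m"] s \<epsilon> by simp
          also have "\<dots> \<le> L * \<epsilon>" using s \<epsilon> L by (intro mult_left_mono) (auto intro: mult_left_le)
          finally show "\<bar>g (x(m := x m + \<epsilon> * s)) - g x\<bar> \<le> L * \<epsilon>" .
        qed
      qed (use i in auto)
      finally show ?thesis .
    qed
    then have "\<bar>h x - f x\<bar> \<le> L * \<epsilon> + m * L * \<epsilon>" for x
      using g(3)[of x] by (intro order_trans[OF abs_triangle_ineq4[of "h x - g x" "f x - g x", simplified]] add_mono) (auto simp: abs_minus_commute)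
    then have "\<bar>h x - f x\<bar> \<le> Suc m * L * \<epsilon>" for x
      by (simp add: distrib_right)
    then show ?case using hr hp' by blast
  qed
  from this[of n] show ?thesis by simp
qed


section \<open>Association of Gaussian sequences\<close>

lemma (in prob_space) gaussian_measure_mean:
  assumes [measurable]: "Y \<in> borel_measurable M" and \<sigma>: "\<sigma> \<ge> 0" and d: "distr M borel Y = gaussian_measure \<mu> \<sigma>"
  shows "integrable M Y" and "(\<integral>\<omega>. Y \<omega> \<partial>M) = \<mu>"
proof -
  have i: "integrable M Y \<longleftrightarrow> integrable (gaussian_measure \<mu> \<sigma>) (\<lambda>y. y)"
    unfolding d[symmetric] by (subst integrable_distr_eq) auto
  have m: "(\<integral>\<omega>. Y \<omega> \<partial>M) = (\<integral>y. y \<partial>gaussian_measure \<mu> \<sigma>)"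
    unfolding d[symmetric] by (subst integral_distr) auto
  have "integrable M Y \<and> (\<integral>\<omega>. Y \<omega> \<partial>M) = \<mu>"
  proof (cases "\<sigma> = 0")
    case True
    then show ?thesis
      unfolding i m by (simp add: gaussian_measure_def integral_return integrable_iff_bounded nn_integral_return)
  next
    case False
    then have "\<sigma> > 0" using \<sigma> by simp
    from normal_moment_nz_1[OF this, of \<mu>] False show ?thesis
      unfolding i m by (simp add: gaussian_measure_def integrable_density integral_density has_bochner_integral_iff)
  qed
  then show "integrable M Y" "(\<integral>\<omega>. Y \<omega> \<partial>M) = \<mu>" by auto
qed

lemma (in prob_space) centered_gaussian_variable:
  assumes [measurable]: "Y \<in> borel_measurable M" and \<sigma>: "\<sigma> \<ge> 0" and d: "distr M borel Y = gaussian_measure 0 \<sigma>"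
  shows "(\<integral>x. iexp (t * Y x) \<partial>M) = exp (- (\<sigma> * t)\<^sup>2 / 2)" (is ?char)
    and "integrable M (\<lambda>x. \<bar>Y x\<bar> ^ k)" (is ?moments)
proof -
  have char: "(\<integral>x. iexp (t * Y x) \<partial>M) = (\<integral>y. iexp (t * y) \<partial>gaussian_measure 0 \<sigma>)"
    unfolding d[symmetric] by (subst integral_distr) auto
  have mom: "integrable M (\<lambda>x. \<bar>Y x\<bar> ^ k) \<longleftrightarrow> integrable (gaussian_measure 0 \<sigma>) (\<lambda>y. \<bar>y\<bar> ^ k)"
    unfolding d[symmetric] by (subst integrable_distr_eq) auto
  have "?char \<and> ?moments"
  proof (cases "\<sigma> = 0")
    case True
    then show ?thesis
      unfolding char mom by (simp add: gaussian_measure_def integral_return integrable_iff_bounded nn_integral_return)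
  next
    case False
    with \<sigma> have \<sigma>: "\<sigma> > 0" by simp
    let ?D = "density lborel (\<lambda>x. ennreal (normal_density 0 \<sigma> x))"
    have D: "gaussian_measure 0 \<sigma> = ?D" using \<sigma> by (simp add: gaussian_measure_def)
    interpret D: prob_space ?D by (rule prob_space_normal_density[OF \<sigma>])
    have "distributed ?D lborel (\<lambda>x. x) (normal_density 0 \<sigma>)"
      by (simp add: distributed_def distr_id2)
    then have "distributed ?D lborel (\<lambda>x. (x - 0) / \<sigma>) std_normal_density"
      by (rule iffD1[OF D.normal_standard_normal_convert[OF \<sigma>, of "\<lambda>x. x" 0]])
    then have Z: "distr ?D lborel (\<lambda>x. x / \<sigma>) = std_normal_distribution"
      by (simp add: distributed_def)
    have "(\<integral>y. iexp (t * y) \<partial>?D) = (\<integral>y. iexp (\<sigma> * t * (y / \<sigma>)) \<partial>?D)"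
      using \<sigma> by simp
    also have "\<dots> = (\<integral>z. iexp (\<sigma> * t * z) \<partial>distr ?D lborel (\<lambda>x. x / \<sigma>))"
      by (subst integral_distr) auto
    also have "\<dots> = exp (- (\<sigma> * t)\<^sup>2 / 2)"
      unfolding Z char_def[symmetric] char_std_normal_distribution ..
    finally have 1: "(\<integral>y. iexp (t * y) \<partial>?D) = exp (- (\<sigma> * t)\<^sup>2 / 2)" .
    have 2: "integrable ?D (\<lambda>y. \<bar>y\<bar> ^ k)"
      using integrable_normal_moment_abs[OF \<sigma>, of 0 k] by (simp add: integrable_density)
    show ?thesis unfolding char mom D using 1 2 by blast
  qed
  then show ?char ?moments by auto
qed

text \<open>Joint Gaussianity is expressed through linear forms, with \<open>\<sigma> = 0\<close>
  allowed; singular covariances and repeated coordinates are thus included.\<close>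

locale centered_gaussian_sequence = prob_space M for M :: "'a measure" +
  fixes X :: "'a \<Rightarrow> nat \<Rightarrow> real"
  assumes X: "X \<in> borel_measurable M"
    and gaussian: "finite S \<Longrightarrow> \<exists>\<sigma>\<ge>0. distr M borel (\<lambda>\<omega>. \<Sum>i\<in>S. c i * X \<omega> i) = gaussian_measure 0 \<sigma>"
begin

lemma X_coord[measurable]: "(\<lambda>\<omega>. X \<omega> i) \<in> borel_measurable M"
  by (rule measurable_product_then_coordinatewise[OF X])

lemma scaled_measurable: "(\<lambda>\<omega> i. a * X \<omega> i) \<in> borel_measurable M"
  by (rule measurable_coordinatewise_then_product) measurable

lemma coord_gaussian: "\<exists>\<sigma>\<ge>0. distr M borel (\<lambda>\<omega>. X \<omega> i) = gaussian_measure 0 \<sigma>"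
  using gaussian[of "{i}" "\<lambda>_. 1"] by simp

lemma coord_moments: "integrable M (\<lambda>\<omega>. \<bar>X \<omega> i\<bar> ^ k)"
  using coord_gaussian[of i] centered_gaussian_variable(2)[OF X_coord] by blast

lemma coord_integrable: "integrable M (\<lambda>\<omega>. X \<omega> i)"
  using coord_gaussian[of i] gaussian_measure_mean(1)[OF X_coord] by blast

lemma coord_mean: "(\<integral>\<omega>. X \<omega> i \<partial>M) = 0"
  using coord_gaussian[of i] gaussian_measure_mean(2)[OF X_coord] by blast

lemma coord_prod_integrable: "integrable M (\<lambda>\<omega>. X \<omega> i * X \<omega> j)"
proof (rule Bochner_Integration.integrable_bound)
  show "integrable M (\<lambda>\<omega>. \<bar>X \<omega> i\<bar>\<^sup>2 + \<bar>X \<omega> j\<bar>\<^sup>2)" by (intro Bochner_Integration.integrable_add coord_moments)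
  show "AE \<omega> in M. norm (X \<omega> i * X \<omega> j) \<le> norm (\<bar>X \<omega> i\<bar>\<^sup>2 + \<bar>X \<omega> j\<bar>\<^sup>2)"
  proof (rule AE_I2)
    fix \<omega>
    have "2 * (\<bar>X \<omega> i\<bar> * \<bar>X \<omega> j\<bar>) \<le> \<bar>X \<omega> i\<bar>\<^sup>2 + \<bar>X \<omega> j\<bar>\<^sup>2"
      using sum_squares_bound[of "\<bar>X \<omega> i\<bar>" "\<bar>X \<omega> j\<bar>"] by simp
    moreover have "0 \<le> \<bar>X \<omega> i\<bar> * \<bar>X \<omega> j\<bar>" by simp
    ultimately have "\<bar>X \<omega> i\<bar> * \<bar>X \<omega> j\<bar> \<le> \<bar>X \<omega> i\<bar>\<^sup>2 + \<bar>X \<omega> j\<bar>\<^sup>2" by linarith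
    then show "norm (X \<omega> i * X \<omega> j) \<le> norm (\<bar>X \<omega> i\<bar>\<^sup>2 + \<bar>X \<omega> j\<bar>\<^sup>2)"
      by (simp add: abs_mult)
  qed
qed measurable

lemma l1_norm_moments: "integrable M (\<lambda>\<omega>. (\<Sum>i<n. \<bar>X \<omega> i\<bar>) ^ k)"
proof (rule Bochner_Integration.integrable_bound)
  \<comment> \<open>The sum is at most \<open>n\<close> times its largest term. The summand
    \<open>1\<close> covers \<open>n = 0\<close>, \<open>k = 0\<close>, where the left side is
    \<open>0 ^ 0 = 1\<close>.\<close>
  show "integrable M (\<lambda>\<omega>. real n ^ k * (\<Sum>i<n. \<bar>X \<omega> i\<bar> ^ k) + 1)"
    by (intro Bochner_Integration.integrable_add integrable_mult_right Bochner_Integration.integrable_sum coord_moments) simp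
  show "AE \<omega> in M. norm ((\<Sum>i<n. \<bar>X \<omega> i\<bar>) ^ k) \<le> norm (real n ^ k * (\<Sum>i<n. \<bar>X \<omega> i\<bar> ^ k) + 1)"
  proof (rule AE_I2)
    fix \<omega>
    let ?x = "\<lambda>i. \<bar>X \<omega> i\<bar>"
    have le: "(\<Sum>i<n. ?x i) ^ k \<le> real n ^ k * (\<Sum>i<n. ?x i ^ k) + 1"
    proof (cases "n = 0")
      case True
      then show ?thesis by (cases k) auto
    next
      case False
      then have "Max (?x ` {..<n}) \<in> ?x ` {..<n}" by (intro Max_in) auto
      then obtain j where j: "j < n" "Max (?x ` {..<n}) = ?x j" by auto
      have "?x i \<le> ?x j" if "i < n" for i
        unfolding j(2)[symmetric] using that by (intro Max_ge) auto
      then have "(\<Sum>i<n. ?x i) \<le> real n * ?x j"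
        using sum_bounded_above[of "{..<n}" ?x "?x j"] by simp
      then have "(\<Sum>i<n. ?x i) ^ k \<le> (real n * ?x j) ^ k" by (intro power_mono sum_nonneg) auto
      also have "\<dots> \<le> real n ^ k * (\<Sum>i<n. ?x i ^ k)"
        unfolding power_mult_distrib using j(1) by (intro mult_left_mono member_le_sum) auto
      also have "\<dots> \<le> real n ^ k * (\<Sum>i<n. ?x i ^ k) + 1" by (rule add_increasing2) auto
      finally show ?thesis .
    qed
    have "0 \<le> (\<Sum>i<n. ?x i) ^ k" by (intro zero_le_power sum_nonneg) auto
    then show "norm ((\<Sum>i<n. ?x i) ^ k) \<le> norm (real n ^ k * (\<Sum>i<n. ?x i ^ k) + 1)"
      by (simp only: real_norm_def abs_of_nonneg) (rule order_trans[OF le abs_ge_self])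
  qed
qed measurable

text \<open>For every linear form the Gaussian characteristic functions of two independent copies
  multiply, and the variances add up to that of the copy scaled by
  \<open>sqrt (a\<^sup>2 + a'\<^sup>2)\<close>; Cramer-Wold then identifies the joint laws.
  Iterating this replaces any larger product space of independent copies.\<close>

lemma average_semigroup:
  assumes f[measurable]: "f \<in> borel_measurable borel" and b: "\<And>x. \<bar>f x\<bar> \<le> b"
  shows "average M (\<lambda>\<omega> i. a * X \<omega> i) (average M (\<lambda>\<omega> i. a' * X \<omega> i) f) x =
    average M (\<lambda>\<omega> i. sqrt (a\<^sup>2 + a'\<^sup>2) * X \<omega> i) f x"
proof -
  let ?N = "M \<Otimes>\<^sub>M M" and ?c = "sqrt (a\<^sup>2 + a'\<^sup>2)"
  interpret N: pair_prob_space M M ..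
  define U where "U z = (\<lambda>i. a * X (fst z) i + a' * X (snd z) i)" for z
  have Ui[measurable]: "(\<lambda>z. U z i) \<in> borel_measurable ?N" for i unfolding U_def by measurable
  have U[measurable]: "U \<in> borel_measurable ?N" by (rule measurable_coordinatewise_then_product) measurable
  note [measurable] = scaled_measurable[of ?c]
  have law: "distr ?N borel U = distr M borel (\<lambda>\<omega> i. ?c * X \<omega> i)"
  proof (rule distr_eqI_linear_combinations)
    show "prob_space ?N" by (rule N.prob_space_axioms)
    show "prob_space M" by (rule prob_space_axioms)
    fix S and d :: "nat \<Rightarrow> real" assume S: "finite (S :: nat set)"
    define Y where "Y \<omega> = (\<Sum>i\<in>S. d i * X \<omega> i)" for \<omega>
    have Y[measurable]: "Y \<in> borel_measurable M" unfolding Y_def by measurable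
    obtain \<sigma> where \<sigma>: "\<sigma> \<ge> 0" "distr M borel Y = gaussian_measure 0 \<sigma>"
      using gaussian[OF S, of d] unfolding Y_def by blast
    note char = centered_gaussian_variable(1)[OF Y \<sigma>]
    have "(\<Sum>i\<in>S. d i * U z i) = a * Y (fst z) + a' * Y (snd z)" for z
      by (simp add: U_def Y_def distrib_left sum.distrib sum_distrib_left mult_ac)
    then have "(\<integral>z. iexp (\<Sum>i\<in>S. d i * U z i) \<partial>?N) = (\<integral>z. iexp (a * Y (fst z)) * iexp (a' * Y (snd z)) \<partial>?N)"
      by (simp add: exp_add[symmetric] distrib_left)
    also have "\<dots> = (\<integral>\<omega>. \<integral>\<omega>'. iexp (a * Y (fst (\<omega>, \<omega>'))) * iexp (a' * Y (snd (\<omega>, \<omega>'))) \<partial>M \<partial>M)"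
      by (rule N.integral_fst'[symmetric]) (auto intro!: N.integrable_const_bound[where B=1] simp: norm_mult)
    also have "\<dots> = complex_of_real (exp (- (\<sigma> * a)\<^sup>2 / 2)) * complex_of_real (exp (- (\<sigma> * a')\<^sup>2 / 2))"
      by (simp only: fst_conv snd_conv integral_mult_right_zero integral_mult_left_zero char)
    also have "\<dots> = complex_of_real (exp (- (\<sigma> * ?c)\<^sup>2 / 2))"
      by (simp add: exp_add[symmetric] power_mult_distrib field_simps flip: of_real_mult)
    also have "\<dots> = (\<integral>\<omega>. iexp (?c * Y \<omega>) \<partial>M)" by (simp only: char)
    also have "(\<lambda>\<omega>. ?c * Y \<omega>) = (\<lambda>\<omega>. \<Sum>i\<in>S. d i * (?c * X \<omega> i))"
      unfolding Y_def sum_distrib_left by (simp only: mult.left_commute)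
    finally show "(\<integral>z. iexp (\<Sum>i\<in>S. d i * U z i) \<partial>?N) = (\<integral>\<omega>. iexp (\<Sum>i\<in>S. d i * (?c * X \<omega> i)) \<partial>M)" .
  qed measurable
  have fx[measurable]: "(\<lambda>y. f (\<lambda>i. x i + y i)) \<in> borel_measurable borel"
  proof -
    have [measurable]: "(\<lambda>y :: nat \<Rightarrow> real. y i) \<in> borel_measurable borel" for i
      by (rule measurable_product_then_coordinatewise) simp
    have [measurable]: "(\<lambda>y i. x i + y i) \<in> borel_measurable borel"
      by (rule measurable_coordinatewise_then_product) measurable
    show ?thesis by measurable
  qed
  have "average M (\<lambda>\<omega> i. a * X \<omega> i) (average M (\<lambda>\<omega> i. a' * X \<omega> i) f) x =
     (\<integral>\<omega>. \<integral>\<omega>'. f (\<lambda>i. x i + U (\<omega>, \<omega>') i) \<partial>M \<partial>M)"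
    by (simp add: average_def U_def add.assoc)
  also have "\<dots> = (\<integral>z. f (\<lambda>i. x i + U z i) \<partial>?N)"
  proof (rule N.integral_fst')
    show "integrable ?N (\<lambda>z. f (\<lambda>i. x i + U z i))"
      by (rule N.shift_integrable[OF U f b])
  qed
  also have "\<dots> = (\<integral>y. f (\<lambda>i. x i + y i) \<partial>distr ?N borel U)"
    by (subst integral_distr) auto
  also have "\<dots> = average M (\<lambda>\<omega> i. ?c * X \<omega> i) f x"
    unfolding law average_def by (subst integral_distr) auto
  finally show ?thesis .
qed

end

section \<open>Pitt's inequality by small Gaussian steps\<close>

locale positively_correlated_gaussian_sequence = centered_gaussian_sequence +
  assumes cov_nonneg: "0 \<le> (\<integral>\<omega>. X \<omega> i * X \<omega> j \<partial>M)"
begin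

text \<open>Write the two shifted functions as \<open>f x + A + r\<close> and
  \<open>g x + B + s\<close> with centered linear forms \<open>A\<close>, \<open>B\<close> of order
  \<open>h\<close> and remainders of order \<open>h ^ 2\<close>. Their covariance is the mean of
  \<open>A * B\<close>, which is nonnegative, plus terms of order at least \<open>h ^ 3\<close>. In
  \<open>C\<close>, the first summand collects the two cross terms \<open>A * s\<close> and
  \<open>r * B\<close>, the second the mean of \<open>r * s\<close>, the third the product of the
  means of \<open>r\<close> and \<open>s\<close>.\<close>

lemma covariance_small_step:
  assumes f: "bounded_mono_lipschitz n b L f" and g: "bounded_mono_lipschitz n b L g"
    and p: "\<And>i. i < n \<Longrightarrow> partial_taylor n L K f i (p i)"
    and q: "\<And>i. i < n \<Longrightarrow> partial_taylor n L K g i (q i)"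
    and LK: "L \<ge> 0" "K \<ge> 0" and h: "0 \<le> h" "h \<le> 1"
  defines "R \<equiv> \<lambda>\<omega>. \<Sum>i<n. \<bar>X \<omega> i\<bar>"
  defines "C \<equiv> 4 * L * K * (\<integral>\<omega>. R \<omega> ^ 3 \<partial>M) + 4 * K\<^sup>2 * (\<integral>\<omega>. R \<omega> ^ 4 \<partial>M) + 4 * K\<^sup>2 * (\<integral>\<omega>. (R \<omega>)\<^sup>2 \<partial>M)\<^sup>2"
  shows "average M (\<lambda>\<omega> i. h * X \<omega> i) (\<lambda>x. f x * g x) x \<ge>
    average M (\<lambda>\<omega> i. h * X \<omega> i) f x * average M (\<lambda>\<omega> i. h * X \<omega> i) g x - C * h ^ 3"
proof -
  have fb: "\<And>x. \<bar>f x\<bar> \<le> b" and fl: "l1_lipschitz n L f" and gb: "\<And>x. \<bar>g x\<bar> \<le> b" and gl: "l1_lipschitz n L g"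
    using f g by (auto simp: bounded_mono_lipschitz_def)
  have [measurable]: "f \<in> borel_measurable borel" "g \<in> borel_measurable borel"
    using fl gl by (auto intro: l1_lipschitz_measurable)
  define F where "F \<omega> = f (\<lambda>i. x i + h * X \<omega> i)" for \<omega>
  define G where "G \<omega> = g (\<lambda>i. x i + h * X \<omega> i)" for \<omega>
  have iF: "integrable M F" and iG: "integrable M G"
    unfolding F_def G_def by (intro shift_integrable[where b=b] scaled_measurable fb gb; measurable)+
  have [measurable]: "F \<in> borel_measurable M" "G \<in> borel_measurable M" using iF iG by auto
  define A where "A \<omega> = (\<Sum>i<n. p i x * (h * X \<omega> i))" for \<omega>
  define B where "B \<omega> = (\<Sum>i<n. q i x * (h * X \<omega> i))" for \<omega>
  define r where "r \<omega> = F \<omega> - f x - A \<omega>" for \<omega>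
  define s where "s \<omega> = G \<omega> - g x - B \<omega>" for \<omega>
  have [measurable]: "A \<in> borel_measurable M" "B \<in> borel_measurable M" "R \<in> borel_measurable M"
    unfolding A_def B_def R_def by measurable
  have [measurable]: "r \<in> borel_measurable M" "s \<in> borel_measurable M"
    unfolding r_def s_def by measurable
  have R0: "0 \<le> R \<omega>" for \<omega> by (simp add: R_def sum_nonneg)
  have iR: "integrable M (\<lambda>\<omega>. R \<omega> ^ k)" for k unfolding R_def by (rule l1_norm_moments)
  have hR: "(\<Sum>i<n. \<bar>h * X \<omega> i\<bar>) = h * R \<omega>" for \<omega>
    using h by (simp add: R_def abs_mult sum_distrib_left)
  have linbound: "\<bar>\<Sum>i<n. d i * (h * X \<omega> i)\<bar> \<le> L * h * R \<omega>" if "\<And>i. i < n \<Longrightarrow> 0 \<le> d i \<and> d i \<le> L" for d \<omega>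
  proof -
    have "\<bar>\<Sum>i<n. d i * (h * X \<omega> i)\<bar> \<le> (\<Sum>i<n. \<bar>d i * (h * X \<omega> i)\<bar>)" by (rule sum_abs)
    also have "\<dots> \<le> (\<Sum>i<n. L * \<bar>h * X \<omega> i\<bar>)"
      using that by (intro sum_mono) (auto simp: abs_mult intro!: mult_right_mono)
    finally show ?thesis unfolding sum_distrib_left[symmetric] hR by (simp add: mult.assoc)
  qed
  have pL: "0 \<le> p i x \<and> p i x \<le> L" and qL: "0 \<le> q i x \<and> q i x \<le> L" if "i < n" for i
    using p[OF that] q[OF that] by (auto simp: partial_taylor_def)
  have Ab: "\<bar>A \<omega>\<bar> \<le> L * h * R \<omega>" and Bb: "\<bar>B \<omega>\<bar> \<le> L * h * R \<omega>" for \<omega>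
    unfolding A_def B_def by (intro linbound pL qL; assumption)+
  have rb: "\<bar>r \<omega>\<bar> \<le> 2 * K * h\<^sup>2 * (R \<omega>)\<^sup>2" for \<omega>
    using taylor_of_partials[OF fl p LK(2), of x "\<lambda>i. h * X \<omega> i"] unfolding hR
    by (simp add: r_def F_def A_def power_mult_distrib mult.assoc)
  have sb: "\<bar>s \<omega>\<bar> \<le> 2 * K * h\<^sup>2 * (R \<omega>)\<^sup>2" for \<omega>
    using taylor_of_partials[OF gl q LK(2), of x "\<lambda>i. h * X \<omega> i"] unfolding hR
    by (simp add: s_def G_def B_def power_mult_distrib mult.assoc)
  have iA: "integrable M A" and iB: "integrable M B"
    unfolding A_def B_def by (intro Bochner_Integration.integrable_sum integrable_mult_right coord_integrable)+
  have EA: "(\<integral>\<omega>. A \<omega> \<partial>M) = 0" and EB: "(\<integral>\<omega>. B \<omega> \<partial>M) = 0"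
    unfolding A_def B_def by (simp_all add: coord_integrable coord_mean)
  have int_r: "integrable M r" and int_s: "integrable M s"
    unfolding r_def s_def by (intro Bochner_Integration.integrable_diff iF iG iA iB; simp)+
  have AB: "A \<omega> * B \<omega> = (\<Sum>i<n. \<Sum>j<n. (p i x * q j x * h\<^sup>2) * (X \<omega> i * X \<omega> j))" for \<omega>
    unfolding A_def B_def sum_product by (simp add: power2_eq_square mult_ac)
  have iAB: "integrable M (\<lambda>\<omega>. A \<omega> * B \<omega>)"
    unfolding AB by (intro Bochner_Integration.integrable_sum integrable_mult_right coord_prod_integrable)
  \<comment> \<open>The nonnegativity of the covariances is used here; monotonicity enters as the
    nonnegativity of the coefficients \<open>p i x\<close> and \<open>q j x\<close>.\<close>
  have EAB: "0 \<le> (\<integral>\<omega>. A \<omega> * B \<omega> \<partial>M)"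
  proof -
    have "(\<integral>\<omega>. A \<omega> * B \<omega> \<partial>M) = (\<Sum>i<n. \<Sum>j<n. (p i x * q j x * h\<^sup>2) * (\<integral>\<omega>. X \<omega> i * X \<omega> j \<partial>M))"
      unfolding AB by (simp add: coord_prod_integrable Bochner_Integration.integral_sum)
    also have "\<dots> \<ge> 0"
      using pL qL cov_nonneg by (intro sum_nonneg mult_nonneg_nonneg) auto
    finally show ?thesis .
  qed
  have R3: "\<bar>A \<omega> * s \<omega>\<bar> \<le> 2 * L * K * h ^ 3 * R \<omega> ^ 3" "\<bar>r \<omega> * B \<omega>\<bar> \<le> 2 * L * K * h ^ 3 * R \<omega> ^ 3"
    and R4: "\<bar>r \<omega> * s \<omega>\<bar> \<le> 4 * K\<^sup>2 * h ^ 3 * R \<omega> ^ 4" for \<omega>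
  proof -
    have "\<bar>A \<omega> * s \<omega>\<bar> \<le> (L * h * R \<omega>) * (2 * K * h\<^sup>2 * (R \<omega>)\<^sup>2)"
      unfolding abs_mult by (intro mult_mono Ab sb) (use LK h R0 in auto)
    then show "\<bar>A \<omega> * s \<omega>\<bar> \<le> 2 * L * K * h ^ 3 * R \<omega> ^ 3"
      by (simp add: power3_eq_cube power2_eq_square mult_ac)
    have "\<bar>r \<omega> * B \<omega>\<bar> \<le> (2 * K * h\<^sup>2 * (R \<omega>)\<^sup>2) * (L * h * R \<omega>)"
      unfolding abs_mult by (intro mult_mono Bb rb) (use LK h R0 in auto)
    then show "\<bar>r \<omega> * B \<omega>\<bar> \<le> 2 * L * K * h ^ 3 * R \<omega> ^ 3"
      by (simp add: power3_eq_cube power2_eq_square mult_ac)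
    have "\<bar>r \<omega> * s \<omega>\<bar> \<le> (2 * K * h\<^sup>2 * (R \<omega>)\<^sup>2) * (2 * K * h\<^sup>2 * (R \<omega>)\<^sup>2)"
      unfolding abs_mult by (intro mult_mono sb rb) (use LK h R0 in auto)
    also have "\<dots> = h ^ 4 * (4 * K\<^sup>2 * R \<omega> ^ 4)"
      by (simp add: power2_eq_square power4_eq_xxxx mult_ac)
    \<comment> \<open>\<open>h \<le> 1\<close> lowers the exponent from 4 to 3, so that all errors
      share the factor \<open>h ^ 3\<close>.\<close>
    also have "\<dots> \<le> h ^ 3 * (4 * K\<^sup>2 * R \<omega> ^ 4)"
      using h by (intro mult_right_mono power_decreasing) auto
    finally show "\<bar>r \<omega> * s \<omega>\<bar> \<le> 4 * K\<^sup>2 * h ^ 3 * R \<omega> ^ 4" by (simp add: mult_ac)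
  qed
  have iAs: "integrable M (\<lambda>\<omega>. A \<omega> * s \<omega>)"
    by (rule Bochner_Integration.integrable_bound[OF integrable_mult_right[OF iR, of "2 * L * K * h ^ 3" 3]])
      (use R3(1) LK h in \<open>auto intro: order_trans[OF _ abs_ge_self]\<close>)
  have irB: "integrable M (\<lambda>\<omega>. r \<omega> * B \<omega>)"
    by (rule Bochner_Integration.integrable_bound[OF integrable_mult_right[OF iR, of "2 * L * K * h ^ 3" 3]])
      (use R3(2) LK h in \<open>auto intro: order_trans[OF _ abs_ge_self]\<close>)
  have irs: "integrable M (\<lambda>\<omega>. r \<omega> * s \<omega>)"
    by (rule Bochner_Integration.integrable_bound[OF integrable_mult_right[OF iR, of "4 * K\<^sup>2 * h ^ 3" 4]])
      (use R4 LK h in \<open>auto intro: order_trans[OF _ abs_ge_self]\<close>)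
  have lower: "(\<integral>\<omega>. t \<omega> \<partial>M) \<ge> - (c * (\<integral>\<omega>. R \<omega> ^ k \<partial>M))" if "integrable M t" "\<And>\<omega>. \<bar>t \<omega>\<bar> \<le> c * R \<omega> ^ k" for t c k
  proof -
    have "(\<integral>\<omega>. - (c * R \<omega> ^ k) \<partial>M) \<le> (\<integral>\<omega>. t \<omega> \<partial>M)"
      using that(2) by (intro integral_mono that(1) integrable_minus integrable_mult_right iR) (simp add: abs_le_iff minus_le_iff)
    then show ?thesis by simp
  qed
  have absE: "\<bar>\<integral>\<omega>. t \<omega> \<partial>M\<bar> \<le> c * (\<integral>\<omega>. R \<omega> ^ k \<partial>M)" if "integrable M t" "\<And>\<omega>. \<bar>t \<omega>\<bar> \<le> c * R \<omega> ^ k" for t c k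
    using lower[OF that] lower[of "\<lambda>\<omega>. - t \<omega>" c k] that by simp
  have "\<bar>(\<integral>\<omega>. r \<omega> \<partial>M) * (\<integral>\<omega>. s \<omega> \<partial>M)\<bar> \<le>
      (2 * K * h\<^sup>2 * (\<integral>\<omega>. (R \<omega>)\<^sup>2 \<partial>M)) * (2 * K * h\<^sup>2 * (\<integral>\<omega>. (R \<omega>)\<^sup>2 \<partial>M))"
    unfolding abs_mult by (intro mult_mono absE int_r int_s rb sb mult_nonneg_nonneg) (use LK in auto)
  also have "\<dots> = h ^ 4 * (4 * K\<^sup>2 * (\<integral>\<omega>. (R \<omega>)\<^sup>2 \<partial>M)\<^sup>2)"
    by (simp add: power2_eq_square power4_eq_xxxx mult_ac)
  also have "\<dots> \<le> h ^ 3 * (4 * K\<^sup>2 * (\<integral>\<omega>. (R \<omega>)\<^sup>2 \<partial>M)\<^sup>2)"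
    using h by (intro mult_right_mono power_decreasing) auto
  finally have Ers: "(\<integral>\<omega>. r \<omega> \<partial>M) * (\<integral>\<omega>. s \<omega> \<partial>M) \<le> 4 * K\<^sup>2 * (\<integral>\<omega>. (R \<omega>)\<^sup>2 \<partial>M)\<^sup>2 * h ^ 3"
    by (simp add: mult_ac abs_le_iff)
  have EF: "(\<integral>\<omega>. F \<omega> \<partial>M) = f x + (\<integral>\<omega>. r \<omega> \<partial>M)"
    unfolding r_def by (simp add: iF iA EA prob_space)
  have EG: "(\<integral>\<omega>. G \<omega> \<partial>M) = g x + (\<integral>\<omega>. s \<omega> \<partial>M)"
    unfolding s_def by (simp add: iG iB EB prob_space)
  \<comment> \<open>The terms \<open>f x * s \<omega>\<close> and \<open>g x * r \<omega>\<close>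
    are only of order \<open>h ^ 2\<close>, but their means recur exactly in the product of the two
    expectations and cancel.\<close>
  have FG: "F \<omega> * G \<omega> = f x * g x + f x * (B \<omega> + s \<omega>) + g x * (A \<omega> + r \<omega>) + A \<omega> * B \<omega> + A \<omega> * s \<omega> + r \<omega> * B \<omega> + r \<omega> * s \<omega>" for \<omega>
  proof -
    have "F \<omega> = f x + A \<omega> + r \<omega>" "G \<omega> = g x + B \<omega> + s \<omega>" by (simp_all add: r_def s_def)
    then show ?thesis by (simp add: algebra_simps)
  qed
  have "(\<integral>\<omega>. F \<omega> * G \<omega> \<partial>M) = f x * g x + f x * (\<integral>\<omega>. s \<omega> \<partial>M) + g x * (\<integral>\<omega>. r \<omega> \<partial>M)
      + (\<integral>\<omega>. A \<omega> * B \<omega> \<partial>M) + (\<integral>\<omega>. A \<omega> * s \<omega> \<partial>M) + (\<integral>\<omega>. r \<omega> * B \<omega> \<partial>M) + (\<integral>\<omega>. r \<omega> * s \<omega> \<partial>M)"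
    unfolding FG by (simp add: iA iB int_r int_s iAB iAs irB irs EA EB prob_space)
  moreover have "(\<integral>\<omega>. A \<omega> * s \<omega> \<partial>M) \<ge> - (2 * L * K * h ^ 3 * (\<integral>\<omega>. R \<omega> ^ 3 \<partial>M))"
    by (rule lower[OF iAs R3(1)])
  moreover have "(\<integral>\<omega>. r \<omega> * B \<omega> \<partial>M) \<ge> - (2 * L * K * h ^ 3 * (\<integral>\<omega>. R \<omega> ^ 3 \<partial>M))"
    by (rule lower[OF irB R3(2)])
  moreover have "(\<integral>\<omega>. r \<omega> * s \<omega> \<partial>M) \<ge> - (4 * K\<^sup>2 * h ^ 3 * (\<integral>\<omega>. R \<omega> ^ 4 \<partial>M))"
    by (rule lower[OF irs R4])
  moreover have "C * h ^ 3 = 2 * L * K * h ^ 3 * (\<integral>\<omega>. R \<omega> ^ 3 \<partial>M) + 2 * L * K * h ^ 3 * (\<integral>\<omega>. R \<omega> ^ 3 \<partial>M)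
      + 4 * K\<^sup>2 * h ^ 3 * (\<integral>\<omega>. R \<omega> ^ 4 \<partial>M) + 4 * K\<^sup>2 * (\<integral>\<omega>. (R \<omega>)\<^sup>2 \<partial>M)\<^sup>2 * h ^ 3"
    unfolding C_def by (simp add: algebra_simps)
  moreover have "(\<integral>\<omega>. F \<omega> \<partial>M) * (\<integral>\<omega>. G \<omega> \<partial>M) = f x * g x + f x * (\<integral>\<omega>. s \<omega> \<partial>M) + g x * (\<integral>\<omega>. r \<omega> \<partial>M)
      + (\<integral>\<omega>. r \<omega> \<partial>M) * (\<integral>\<omega>. s \<omega> \<partial>M)"
    unfolding EF EG by (simp add: algebra_simps)
  ultimately have "(\<integral>\<omega>. F \<omega> * G \<omega> \<partial>M) \<ge> (\<integral>\<omega>. F \<omega> \<partial>M) * (\<integral>\<omega>. G \<omega> \<partial>M) - C * h ^ 3"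
    using EAB Ers by linarith
  then show ?thesis unfolding average_def F_def G_def .
qed

text \<open>After \<open>k\<close> steps of size \<open>h\<close> the defect is at most
  \<open>k * (C * h ^ 3)\<close>. The constant \<open>C\<close> never changes, because the averaged
  functions satisfy the same bounds with the same \<open>L\<close> and \<open>K\<close>. With
  \<open>h = 1 / sqrt (Suc N)\<close> and \<open>Suc N\<close> steps the total shift has the law of
  \<open>X\<close>.\<close>

lemma association_smooth:
  assumes f: "bounded_mono_lipschitz n b L f" and g: "bounded_mono_lipschitz n b L g"
    and p: "\<And>i. i < n \<Longrightarrow> \<exists>p. partial_taylor n L K f i p"
    and q: "\<And>i. i < n \<Longrightarrow> \<exists>q. partial_taylor n L K g i q"
    and LK: "L \<ge> 0" "K \<ge> 0"
  shows "(\<integral>\<omega>. f (X \<omega>) * g (X \<omega>) \<partial>M) \<ge> (\<integral>\<omega>. f (X \<omega>) \<partial>M) * (\<integral>\<omega>. g (X \<omega>) \<partial>M)"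
proof -
  define C where "C = 4 * L * K * (\<integral>\<omega>. (\<Sum>i<n. \<bar>X \<omega> i\<bar>) ^ 3 \<partial>M) + 4 * K\<^sup>2 * (\<integral>\<omega>. (\<Sum>i<n. \<bar>X \<omega> i\<bar>) ^ 4 \<partial>M)
    + 4 * K\<^sup>2 * (\<integral>\<omega>. (\<Sum>i<n. \<bar>X \<omega> i\<bar>)\<^sup>2 \<partial>M)\<^sup>2"
  have fb: "\<And>x. \<bar>f x\<bar> \<le> b" and fl: "l1_lipschitz n L f" and gb: "\<And>x. \<bar>g x\<bar> \<le> b" and gl: "l1_lipschitz n L g"
    using f g by (auto simp: bounded_mono_lipschitz_def)
  let ?W = "\<lambda>a. average M (\<lambda>\<omega> i. a * X \<omega> i)"
  have b0: "b \<ge> 0" using fb order_trans[OF abs_ge_zero] by blast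
  have fgb: "\<bar>f x * g x\<bar> \<le> b * b" for x
    unfolding abs_mult by (intro mult_mono fb gb b0) auto
  note fgl = l1_lipschitz_mult[OF fl fb gl gb]
  note ms = fl[THEN l1_lipschitz_measurable] gl[THEN l1_lipschitz_measurable] fgl[THEN l1_lipschitz_measurable]
  \<comment> \<open>The squares of the step sizes add up: one more step of size \<open>h\<close>
    takes the scale from \<open>sqrt k * h\<close> to \<open>sqrt (Suc k) * h\<close>.\<close>
  have W: "?W (sqrt (Suc k) * h) u x = ?W h (?W (sqrt k * h) u) x"
    if "u \<in> borel_measurable borel" "\<And>x. \<bar>u x\<bar> \<le> c" "h \<ge> 0" for k :: nat and h u c x
  proof -
    have "sqrt (h\<^sup>2 + (sqrt k * h)\<^sup>2) = sqrt (Suc k) * h"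
      using that(3) by (intro real_sqrt_unique) (auto simp: power_mult_distrib distrib_right)
    then show ?thesis using average_semigroup[OF that(1,2), of h "sqrt k * h" x] by simp
  qed
  have step: "?W (sqrt k * h) (\<lambda>x. f x * g x) x \<ge> ?W (sqrt k * h) f x * ?W (sqrt k * h) g x - k * (C * h ^ 3)"
    if h: "0 \<le> h" "h \<le> 1" for k :: nat and h x
  proof (induction k arbitrary: x)
    case 0
    then show ?case by (simp add: average_def prob_space)
  next
    case (Suc k)
    let ?u = "?W (sqrt k * h) f" and ?v = "?W (sqrt k * h) g" and ?w = "?W (sqrt k * h) (\<lambda>x. f x * g x)"
    note sm = scaled_measurable[of "sqrt k * h"]
    have u: "bounded_mono_lipschitz n b L ?u" and v: "bounded_mono_lipschitz n b L ?v"
      by (intro average_bounded_mono_lipschitz sm f g)+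
    have w: "l1_lipschitz n (2 * b * L) ?w" "\<And>x. \<bar>?w x\<bar> \<le> b * b"
      by (intro average_lipschitz[OF sm fgl fgb] average_bounded[OF sm ms(3) fgb])+
    have ub: "\<And>x. \<bar>?u x\<bar> \<le> b" and ul: "l1_lipschitz n L ?u" and vb: "\<And>x. \<bar>?v x\<bar> \<le> b" and vl: "l1_lipschitz n L ?v"
      using u v by (auto simp: bounded_mono_lipschitz_def)
    have uvb: "\<bar>?u x * ?v x\<bar> \<le> b * b" for x
      unfolding abs_mult by (intro mult_mono ub vb b0) auto
    note uvl = l1_lipschitz_mult[OF ul ub vl vb]
    have "\<forall>i<n. \<exists>p. partial_taylor n L K ?u i p" "\<forall>i<n. \<exists>p. partial_taylor n L K ?v i p"
      using average_partial_taylor[OF sm fl fb] average_partial_taylor[OF sm gl gb] p q by meson+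
    then obtain p' q' where p': "\<And>i. i < n \<Longrightarrow> partial_taylor n L K ?u i (p' i)"
      and q': "\<And>i. i < n \<Longrightarrow> partial_taylor n L K ?v i (q' i)" by metis
    have i1: "integrable M (\<lambda>\<omega>. ?u (\<lambda>i. x i + h * X \<omega> i) * ?v (\<lambda>i. x i + h * X \<omega> i))"
      by (rule shift_integrable[OF scaled_measurable l1_lipschitz_measurable[OF uvl] uvb])
    have i2: "integrable M (\<lambda>\<omega>. ?w (\<lambda>i. x i + h * X \<omega> i))"
      by (rule shift_integrable[OF scaled_measurable l1_lipschitz_measurable[OF w(1)] w(2)])
    \<comment> \<open>The small-step bound is applied to the already averaged functions. The
      induction hypothesis is then integrated over all shifted base points, which is why
      \<open>x\<close> is arbitrary in the induction.\<close>
    have "?W h ?u x * ?W h ?v x - C * h ^ 3 \<le> ?W h (\<lambda>x. ?u x * ?v x) x"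
      unfolding C_def by (rule covariance_small_step[OF u v p' q' LK h])
    also have "\<dots> \<le> ?W h (\<lambda>x. ?w x + k * (C * h ^ 3)) x"
      unfolding average_def[of M "\<lambda>\<omega> i. h * X \<omega> i"]
      using Suc.IH by (intro integral_mono i1 Bochner_Integration.integrable_add i2) (auto simp: algebra_simps)
    also have "\<dots> = ?W h ?w x + k * (C * h ^ 3)"
      unfolding average_def[of M "\<lambda>\<omega> i. h * X \<omega> i"] using i2 by (simp add: prob_space)
    finally show ?case
      unfolding W[OF ms(1) fb h(1)] W[OF ms(2) gb h(1)] W[OF ms(3) fgb h(1)]
      by (simp add: algebra_simps)
  qed
  have "(\<integral>\<omega>. f (X \<omega>) * g (X \<omega>) \<partial>M) \<ge> (\<integral>\<omega>. f (X \<omega>) \<partial>M) * (\<integral>\<omega>. g (X \<omega>) \<partial>M) - C / sqrt (Suc N)" for N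
  proof -
    let ?h = "1 / sqrt (Suc N)"
    have ss: "real (Suc N) = sqrt (Suc N) * sqrt (Suc N)" by simp
    \<comment> \<open>\<open>Suc N\<close> errors of order \<open>?h ^ 3\<close> sum to order
      \<open>?h\<close>, which tends to 0.\<close>
    have "Suc N * ?h ^ 3 = ?h"
      by (subst ss) (simp add: power3_eq_cube del: real_sqrt_mult_self of_nat_Suc)
    then have "C * (Suc N * ?h ^ 3) = C * ?h" by simp
    then have e: "Suc N * (C * ?h ^ 3) = C / sqrt (Suc N)"
      by (simp only: mult.left_commute times_divide_eq_right mult_1_right)
    have "sqrt (Suc N) * ?h = 1" by simp
    with step[of ?h "Suc N" "\<lambda>_. 0"] show ?thesis
      unfolding e by (simp add: average_def)
  qed
  moreover have "filterlim (\<lambda>N. sqrt (real (Suc N))) at_top sequentially"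
    by (intro filterlim_compose[OF sqrt_at_top] filterlim_compose[OF filterlim_real_sequentially] filterlim_Suc)
  from tendsto_diff[OF tendsto_const tendsto_divide_0[OF tendsto_const filterlim_at_top_imp_at_infinity[OF this]]]
  have "(\<lambda>N. (\<integral>\<omega>. f (X \<omega>) \<partial>M) * (\<integral>\<omega>. g (X \<omega>) \<partial>M) - C / sqrt (Suc N)) \<longlonglongrightarrow>
      (\<integral>\<omega>. f (X \<omega>) \<partial>M) * (\<integral>\<omega>. g (X \<omega>) \<partial>M) - 0" .
  ultimately show ?thesis
    by (intro LIMSEQ_le_const2[where X = "\<lambda>N. (\<integral>\<omega>. f (X \<omega>) \<partial>M) * (\<integral>\<omega>. g (X \<omega>) \<partial>M) - C / sqrt (Suc N)"]) auto
qed

text \<open>Mollification keeps \<open>b\<close> and \<open>L\<close> but has Taylor constant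
  \<open>2 * L / \<epsilon>\<close>. Its blow-up is harmless: \<open>association_smooth\<close>
  leaves no error term, so only the uniform distance between the functions and their mollifications
  has to become small.\<close>

theorem association:
  assumes f: "bounded_mono_lipschitz n b L f" and g: "bounded_mono_lipschitz n b L g" and L: "L \<ge> 0"
  shows "(\<integral>\<omega>. f (X \<omega>) * g (X \<omega>) \<partial>M) \<ge> (\<integral>\<omega>. f (X \<omega>) \<partial>M) * (\<integral>\<omega>. g (X \<omega>) \<partial>M)"
proof (rule field_le_epsilon)
  fix e :: real assume e: "e > 0"
  have facts: "\<And>x. \<bar>u x\<bar> \<le> b" "u \<in> borel_measurable borel" if "bounded_mono_lipschitz n b L u" for u
    using that by (auto simp: bounded_mono_lipschitz_def intro: l1_lipschitz_measurable)
  have b: "b \<ge> 0" using facts(1)[OF f] order_trans[OF abs_ge_zero] by blast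
  \<comment> \<open>Each side of the inequality changes by at most
    \<open>2 * b * (n * L * \<epsilon>)\<close>, so \<open>c\<close> must dominate
    \<open>4 * b * n * L\<close>; the added ones keep it positive.\<close>
  define c where "c = 4 * (b + 1) * ((n + 1) * (L + 1))"
  have c: "c > 0" using b L by (auto simp: c_def intro!: mult_pos_pos)
  define \<epsilon> where "\<epsilon> = e / c"
  have \<epsilon>: "\<epsilon> > 0" using e c by (simp add: \<epsilon>_def)
  let ?d = "real n * L * \<epsilon>"
  have small: "4 * b * ?d \<le> e"
  proof -
    have "4 * b * (n * L) \<le> c"
      unfolding c_def using b L by (intro mult_mono) auto
    then have "4 * b * (n * L) * \<epsilon> \<le> c * \<epsilon>"
      using \<epsilon> by (intro mult_right_mono) auto
    also have "\<dots> = e" using c by (simp add: \<epsilon>_def)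
    finally show ?thesis by (simp add: mult_ac)
  qed
  obtain f' where f': "bounded_mono_lipschitz n b L f'" "\<forall>i<n. \<exists>p. partial_taylor n L (2 * L / \<epsilon>) f' i p"
    "\<And>x. \<bar>f' x - f x\<bar> \<le> ?d" using mollification[OF f \<epsilon>] by blast
  obtain g' where g': "bounded_mono_lipschitz n b L g'" "\<forall>i<n. \<exists>p. partial_taylor n L (2 * L / \<epsilon>) g' i p"
    "\<And>x. \<bar>g' x - g x\<bar> \<le> ?d" using mollification[OF g \<epsilon>] by blast
  note [measurable] = facts(2)[OF f] facts(2)[OF g] facts(2)[OF f'(1)] facts(2)[OF g'(1)] X
  note bd = facts(1)[OF f] facts(1)[OF g] facts(1)[OF f'(1)] facts(1)[OF g'(1)]
  have i: "integrable M (\<lambda>\<omega>. u (X \<omega>))" if "u \<in> borel_measurable borel" "\<And>x. \<bar>u x\<bar> \<le> c" for u :: "(nat \<Rightarrow> real) \<Rightarrow> real" and c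
    using that X by (intro integrable_const_bound[where B=c]) (auto intro: measurable_compose)
  have pb: "\<bar>u x * v x\<bar> \<le> b * b" if "\<And>x. \<bar>u x\<bar> \<le> b" "\<And>x. \<bar>v x\<bar> \<le> b" for u v :: "(nat \<Rightarrow> real) \<Rightarrow> real" and x
    unfolding abs_mult by (intro mult_mono that b) auto
  have ip: "integrable M (\<lambda>\<omega>. f (X \<omega>) * g (X \<omega>))" "integrable M (\<lambda>\<omega>. f' (X \<omega>) * g' (X \<omega>))"
    by (intro i[of "\<lambda>x. f x * g x" "b * b"] i[of "\<lambda>x. f' x * g' x" "b * b"] pb bd; measurable)+
  note i1 = i[OF facts(2)[OF f] bd(1)] i[OF facts(2)[OF g] bd(2)] i[OF facts(2)[OF f'(1)] bd(3)] i[OF facts(2)[OF g'(1)] bd(4)]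
  have prod: "\<bar>s * t - s' * t'\<bar> \<le> 2 * b * ?d" if "\<bar>s\<bar> \<le> b" "\<bar>t'\<bar> \<le> b" "\<bar>s - s'\<bar> \<le> ?d" "\<bar>t - t'\<bar> \<le> ?d" for s t s' t' :: real
  proof -
    have "s * t - s' * t' = s * (t - t') + t' * (s - s')" by (simp add: algebra_simps)
    also have "\<bar>\<dots>\<bar> \<le> \<bar>s\<bar> * \<bar>t - t'\<bar> + \<bar>t'\<bar> * \<bar>s - s'\<bar>" by (metis abs_mult abs_triangle_ineq)
    also have "\<dots> \<le> b * ?d + b * ?d" by (intro add_mono mult_mono that b) auto
    finally show ?thesis by (simp only: mult_2 distrib_right)
  qed
  have D: "\<bar>(\<integral>\<omega>. u (X \<omega>) \<partial>M) - (\<integral>\<omega>. v (X \<omega>) \<partial>M)\<bar> \<le> c"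
    if "integrable M (\<lambda>\<omega>. u (X \<omega>))" "integrable M (\<lambda>\<omega>. v (X \<omega>))" "\<And>x. \<bar>u x - v x\<bar> \<le> c" for u v :: "(nat \<Rightarrow> real) \<Rightarrow> real" and c
    using abs_integral_le[of "\<lambda>\<omega>. u (X \<omega>) - v (X \<omega>)" c] that by simp
  have "\<bar>(\<integral>\<omega>. f (X \<omega>) * g (X \<omega>) \<partial>M) - (\<integral>\<omega>. f' (X \<omega>) * g' (X \<omega>) \<partial>M)\<bar> \<le> 2 * b * ?d"
    using bd f'(3) g'(3) by (intro D[of "\<lambda>x. f x * g x" "\<lambda>x. f' x * g' x"] ip prod) (auto simp: abs_minus_commute)
  moreover have "\<bar>(\<integral>\<omega>. f (X \<omega>) \<partial>M) * (\<integral>\<omega>. g (X \<omega>) \<partial>M) - (\<integral>\<omega>. f' (X \<omega>) \<partial>M) * (\<integral>\<omega>. g' (X \<omega>) \<partial>M)\<bar> \<le> 2 * b * ?d"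
    using f'(3) g'(3) by (intro prod D abs_integral_le i1 bd) (auto simp: abs_minus_commute)
  moreover have "(\<integral>\<omega>. f' (X \<omega>) * g' (X \<omega>) \<partial>M) \<ge> (\<integral>\<omega>. f' (X \<omega>) \<partial>M) * (\<integral>\<omega>. g' (X \<omega>) \<partial>M)"
    using f'(2) g'(2) L \<epsilon> by (intro association_smooth[OF f'(1) g'(1), where K = "2 * L / \<epsilon>"]) auto
  ultimately show "(\<integral>\<omega>. f (X \<omega>) \<partial>M) * (\<integral>\<omega>. g (X \<omega>) \<partial>M) \<le> (\<integral>\<omega>. f (X \<omega>) * g (X \<omega>) \<partial>M) + e"
    using small by linarith
qed

end


section \<open>Functionals on the path space\<close>

lemma C_dist_le:
  assumes "0 \<le> c" "\<And>t. t \<in> {0..T} \<Longrightarrow> \<bar>\<alpha> t - \<beta> t\<bar> \<le> c"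
  shows "mdist (C_metric T) \<alpha> \<beta> \<le> c"
  unfolding C_metric_def by (rule mdist_cfunspace_le) (use assms in \<open>auto simp: dist_real_def\<close>)

lemma le_C_dist:
  assumes "\<alpha> \<in> C_space T" "\<beta> \<in> C_space T" "t \<in> {0..T}"
  shows "\<bar>\<alpha> t - \<beta> t\<bar> \<le> mdist (C_metric T) \<alpha> \<beta>"
  using mdist_cfunspace_imp_mdist_le[of \<alpha> "top_of_set {0..T}" euclidean_metric \<beta> "mdist (C_metric T) \<alpha> \<beta>" t] assms
  by (simp add: C_metric_def dist_real_def)

lemma C_spaceI:
  assumes "continuous_on {0..T} f"
  shows "(\<lambda>t\<in>{0..T}. f t) \<in> C_space T"
proof -
  have "continuous_on {0..T} (\<lambda>t\<in>{0..T}. f t)"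
    using assms by (rule continuous_on_eq) simp
  then show ?thesis
    unfolding mspace_C_metric by (simp only: mem_Collect_eq restrict_extensional)
qed

lemma C_spaceD: "f \<in> C_space T \<Longrightarrow> continuous_on {0..T} f"
  by (auto simp: mspace_C_metric)

lemma topcontinuous_at_C_metricD:
  assumes "topcontinuous_at (C_topology T) euclidean F \<alpha>" and "e > 0"
  shows "\<exists>\<delta>>0. \<forall>\<beta>\<in>C_space T. mdist (C_metric T) \<alpha> \<beta> < \<delta> \<longrightarrow> \<bar>F \<beta> - F \<alpha>\<bar> < (e::real)"
proof -
  interpret C: Metric_space "C_space T" "mdist (C_metric T)" by simp
  obtain U where U: "openin (C_topology T) U" "\<alpha> \<in> U" "\<And>\<beta>. \<beta> \<in> U \<Longrightarrow> F \<beta> \<in> ball (F \<alpha>) e"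
    using assms unfolding topcontinuous_at_def by (metis centre_in_ball open_ball open_openin)
  then obtain r where r: "r > 0" "C.mball \<alpha> r \<subseteq> U"
    unfolding mtopology_of_def C.openin_mtopology by blast
  have \<alpha>: "\<alpha> \<in> C_space T" using assms(1) by (simp add: topcontinuous_at_def)
  have "\<bar>F \<beta> - F \<alpha>\<bar> < e" if "\<beta> \<in> C_space T" "mdist (C_metric T) \<alpha> \<beta> < r" for \<beta>
  proof -
    have "\<beta> \<in> C.mball \<alpha> r" using that \<alpha> by (simp only: C.in_mball)
    then have "F \<beta> \<in> ball (F \<alpha>) e" using U(3) r(2) by blast
    then show ?thesis by (simp add: dist_real_def abs_minus_commute)
  qed
  with r(1) show ?thesis by blast
qed

section \<open>The Pasch-Hausdorff envelope, the largest \<open>L\<close>-Lipschitz minorant on the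
  path space\<close>

definition lipschitz_envelope :: "real \<Rightarrow> real \<Rightarrow> ((real \<Rightarrow> real) \<Rightarrow> real) \<Rightarrow> (real \<Rightarrow> real) \<Rightarrow> real" where
  "lipschitz_envelope T L F \<alpha> = (INF \<beta>\<in>C_space T. F \<beta> + L * mdist (C_metric T) \<alpha> \<beta>)"

context
  fixes T L b :: real and F :: "(real \<Rightarrow> real) \<Rightarrow> real"
  assumes L: "L \<ge> 0" and b: "\<forall>\<alpha>\<in>C_space T. \<bar>F \<alpha>\<bar> \<le> b"
begin

lemma C_nonempty: "(\<lambda>t\<in>{0..T}. 0) \<in> C_space T"
  by (rule C_spaceI) simp

lemma envelope_bdd_below: "bdd_below ((\<lambda>\<beta>. F \<beta> + L * mdist (C_metric T) \<alpha> \<beta>) ` C_space T)"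
proof (rule bdd_belowI2)
  show "- b \<le> F \<beta> + L * mdist (C_metric T) \<alpha> \<beta>" if "\<beta> \<in> C_space T" for \<beta>
    using bspec[OF b that] mult_nonneg_nonneg[OF L mdist_nonneg, of "C_metric T" \<alpha> \<beta>] by linarith
qed

lemma envelope_lower: "\<beta> \<in> C_space T \<Longrightarrow> lipschitz_envelope T L F \<alpha> \<le> F \<beta> + L * mdist (C_metric T) \<alpha> \<beta>"
  unfolding lipschitz_envelope_def by (rule cINF_lower[OF envelope_bdd_below])

lemma envelope_greatest:
  "(\<And>\<beta>. \<beta> \<in> C_space T \<Longrightarrow> c \<le> F \<beta> + L * mdist (C_metric T) \<alpha> \<beta>) \<Longrightarrow> c \<le> lipschitz_envelope T L F \<alpha>"
  unfolding lipschitz_envelope_def using C_nonempty by (intro cINF_greatest) auto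

lemma envelope_le:
  assumes "\<alpha> \<in> C_space T"
  shows "lipschitz_envelope T L F \<alpha> \<le> F \<alpha>"
proof -
  have "mdist (C_metric T) \<alpha> \<alpha> = 0"
    by (intro antisym C_dist_le mdist_nonneg) auto
  with envelope_lower[OF assms, of \<alpha>] show ?thesis by simp
qed

lemma envelope_bounded:
  assumes "\<alpha> \<in> C_space T"
  shows "\<bar>lipschitz_envelope T L F \<alpha>\<bar> \<le> b"
proof -
  have "- b \<le> lipschitz_envelope T L F \<alpha>"
  proof (rule envelope_greatest)
    show "- b \<le> F \<beta> + L * mdist (C_metric T) \<alpha> \<beta>" if "\<beta> \<in> C_space T" for \<beta>
      using bspec[OF b that] mult_nonneg_nonneg[OF L mdist_nonneg, of "C_metric T" \<alpha> \<beta>] by linarith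
  qed
  then show ?thesis using envelope_le[OF assms] bspec[OF b assms] by linarith
qed

lemma envelope_lipschitz:
  assumes \<alpha>: "\<alpha> \<in> C_space T" and \<alpha>': "\<alpha>' \<in> C_space T"
  shows "\<bar>lipschitz_envelope T L F \<alpha> - lipschitz_envelope T L F \<alpha>'\<bar> \<le> L * mdist (C_metric T) \<alpha> \<alpha>'"
proof -
  have *: "lipschitz_envelope T L F x - L * mdist (C_metric T) x y \<le> lipschitz_envelope T L F y"
    if x: "x \<in> C_space T" and y: "y \<in> C_space T" for x y
  proof (rule envelope_greatest)
    fix \<beta> assume \<beta>: "\<beta> \<in> C_space T"
    have "L * mdist (C_metric T) x \<beta> \<le> L * (mdist (C_metric T) x y + mdist (C_metric T) y \<beta>)"
      by (intro mult_left_mono mdist_triangle x y \<beta> L)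
    then show "lipschitz_envelope T L F x - L * mdist (C_metric T) x y \<le> F \<beta> + L * mdist (C_metric T) y \<beta>"
      using envelope_lower[OF \<beta>, of x] by (simp add: distrib_left)
  qed
  show ?thesis
    using *[OF \<alpha> \<alpha>'] *[OF \<alpha>' \<alpha>] by (simp add: abs_le_iff mdist_commute)
qed

lemma envelope_mono:
  assumes F: "monotone_on (C_space T) (C_le T) (\<le>) F"
    and \<alpha>: "\<alpha> \<in> C_space T" and \<alpha>': "\<alpha>' \<in> C_space T" and le: "C_le T \<alpha> \<alpha>'"
  shows "lipschitz_envelope T L F \<alpha> \<le> lipschitz_envelope T L F \<alpha>'"
proof (rule envelope_greatest)
  fix \<beta>' assume \<beta>': "\<beta>' \<in> C_space T"
  \<comment> \<open>Translating \<open>\<beta>'\<close> by \<open>\<alpha> - \<alpha>'\<close> keeps the distance and decreases \<open>F\<close>.\<close>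
  define \<beta> where "\<beta> = (\<lambda>t\<in>{0..T}. \<beta>' t + (\<alpha> t - \<alpha>' t))"
  have \<beta>: "\<beta> \<in> C_space T"
    unfolding \<beta>_def by (intro C_spaceI continuous_intros C_spaceD \<alpha> \<alpha>' \<beta>')
  have "C_le T \<beta> \<beta>'" using le by (auto simp: C_le_def \<beta>_def)
  then have "F \<beta> \<le> F \<beta>'" using F \<beta> \<beta>' by (auto simp: monotone_on_def)
  moreover have "mdist (C_metric T) \<alpha> \<beta> \<le> mdist (C_metric T) \<alpha>' \<beta>'"
  proof (rule C_dist_le)
    show "\<bar>\<alpha> t - \<beta> t\<bar> \<le> mdist (C_metric T) \<alpha>' \<beta>'" if "t \<in> {0..T}" for t
      using le_C_dist[OF \<alpha>' \<beta>' that] that by (simp add: \<beta>_def)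
  qed simp
  ultimately show "lipschitz_envelope T L F \<alpha> \<le> F \<beta>' + L * mdist (C_metric T) \<alpha>' \<beta>'"
    using envelope_lower[OF \<beta>, of \<alpha>] mult_left_mono[OF _ L] by (meson add_mono order_trans)
qed

end

text \<open>Within distance \<open>\<delta>\<close> of \<open>\<alpha>\<close>, continuity keeps
  \<open>F\<close> above \<open>F \<alpha> - e / 2\<close>; farther away the penalty is at least
  \<open>k * \<delta>\<close>, which exceeds the largest possible oscillation \<open>2 * b\<close>
  once \<open>k\<close> is large.\<close>

lemma envelope_tendsto:
  assumes b: "\<forall>\<alpha>\<in>C_space T. \<bar>F \<alpha>\<bar> \<le> b" and cont: "topcontinuous_at (C_topology T) euclidean F \<alpha>"
    and \<alpha>: "\<alpha> \<in> C_space T"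
  shows "(\<lambda>k. lipschitz_envelope T (real k) F \<alpha>) \<longlonglongrightarrow> F \<alpha>"
proof (rule LIMSEQ_I)
  fix e :: real assume "e > 0"
  then have "e / 2 > 0" by simp
  from topcontinuous_at_C_metricD[OF cont this] obtain \<delta> where \<delta>: "\<delta> > 0"
    "\<And>\<beta>. \<beta> \<in> C_space T \<Longrightarrow> mdist (C_metric T) \<alpha> \<beta> < \<delta> \<Longrightarrow> \<bar>F \<beta> - F \<alpha>\<bar> < e / 2" by blast
  obtain N where N: "real N \<ge> 2 * b / \<delta>" using real_arch_simple by blast
  show "\<exists>N. \<forall>k\<ge>N. norm (lipschitz_envelope T (real k) F \<alpha> - F \<alpha>) < e"
  proof (intro exI allI impI)
    fix k assume "N \<le> k"
    have "F \<alpha> - e / 2 \<le> lipschitz_envelope T (real k) F \<alpha>"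
    proof (rule envelope_greatest[OF _ b])
      fix \<beta> assume \<beta>: "\<beta> \<in> C_space T"
      show "F \<alpha> - e / 2 \<le> F \<beta> + real k * mdist (C_metric T) \<alpha> \<beta>"
      proof (cases "mdist (C_metric T) \<alpha> \<beta> < \<delta>")
        case True
        have "0 \<le> real k * mdist (C_metric T) \<alpha> \<beta>" by simp
        with \<delta>(2)[OF \<beta> True] show ?thesis by linarith
      next
        case False
        have "2 * b \<le> real N * \<delta>" using N \<delta>(1) by (simp add: pos_divide_le_eq)
        also have "\<dots> \<le> real k * mdist (C_metric T) \<alpha> \<beta>"
          using False \<open>N \<le> k\<close> \<delta>(1) by (intro mult_mono) auto
        finally show ?thesis using bspec[OF b \<beta>] bspec[OF b \<alpha>] \<open>e > 0\<close> by linarith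
      qed
    qed auto
    moreover have "lipschitz_envelope T (real k) F \<alpha> \<le> F \<alpha>"
      by (rule envelope_le[OF _ b \<alpha>]) auto
    ultimately show "norm (lipschitz_envelope T (real k) F \<alpha> - F \<alpha>) < e"
      using \<open>e > 0\<close> unfolding real_norm_def abs_less_iff by linarith
  qed
qed

section \<open>Bernstein polynomials built from values on a grid\<close>

definition bernstein_path :: "real \<Rightarrow> nat \<Rightarrow> (nat \<Rightarrow> real) \<Rightarrow> real \<Rightarrow> real" where
  "bernstein_path T n x = (\<lambda>t\<in>{0..T}. \<Sum>k\<le>n. x k * Bernstein n k (t / T))"

text \<open>The truncation \<open>min k n\<close> sends every index into the time interval, so that
  the grid values form a full infinite sequence; the Bernstein path of degree \<open>n\<close> reads
  only the indices up to \<open>n\<close>.\<close>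

definition grid_time :: "real \<Rightarrow> nat \<Rightarrow> nat \<Rightarrow> real" where
  "grid_time T n k = T * (real (min k n) / real n)"

lemma grid_time_in:
  assumes "T \<ge> 0"
  shows "grid_time T n k \<in> {0..T}"
proof -
  have "0 \<le> real (min k n) / real n" "real (min k n) / real n \<le> 1"
    by (auto simp: divide_le_eq_1)
  then show ?thesis
    using assms mult_left_le[of "real (min k n) / real n" T] unfolding grid_time_def
    by (simp only: atLeastAtMost_iff mult_nonneg_nonneg)
qed

lemma bernstein_path_in: "bernstein_path T n x \<in> C_space T"
  unfolding bernstein_path_def Bernstein_def by (intro C_spaceI) (auto intro!: continuous_intros simp: divide_inverse)

lemma Bernstein_le_1:
  assumes "0 \<le> x" "x \<le> 1" "k \<le> n"
  shows "Bernstein n k x \<le> 1"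
proof -
  have "Bernstein n k x \<le> (\<Sum>k\<le>n. Bernstein n k x)"
    using assms by (intro member_le_sum Bernstein_nonneg) auto
  then show ?thesis by simp
qed

lemma bernstein_path_mono:
  assumes "T > 0" "x \<le> y"
  shows "C_le T (bernstein_path T n x) (bernstein_path T n y)"
  unfolding C_le_def bernstein_path_def using assms
  by (auto intro!: sum_mono mult_right_mono Bernstein_nonneg simp: le_fun_def)

lemma bernstein_path_lipschitz:
  assumes T: "T > 0"
  shows "mdist (C_metric T) (bernstein_path T n x) (bernstein_path T n y) \<le> (\<Sum>i<Suc n. \<bar>x i - y i\<bar>)"
proof (rule C_dist_le)
  fix t assume t: "t \<in> {0..T}"
  then have t': "0 \<le> t / T" "t / T \<le> 1" using T by auto
  have "bernstein_path T n x t - bernstein_path T n y t = (\<Sum>k\<le>n. (x k - y k) * Bernstein n k (t / T))"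
    using t by (simp add: bernstein_path_def sum_subtractf left_diff_distrib)
  also have "\<bar>\<dots>\<bar> \<le> (\<Sum>k\<le>n. \<bar>(x k - y k) * Bernstein n k (t / T)\<bar>)" by (rule sum_abs)
  also have "\<dots> \<le> (\<Sum>k\<le>n. \<bar>x k - y k\<bar>)"
    using t' by (intro sum_mono) (auto simp: abs_mult Bernstein_nonneg intro!: mult_left_le Bernstein_le_1)
  finally show "\<bar>bernstein_path T n x t - bernstein_path T n y t\<bar> \<le> (\<Sum>i<Suc n. \<bar>x i - y i\<bar>)"
    by (simp add: lessThan_Suc_atMost)
qed (simp add: sum_nonneg)

lemma bernstein_path_tendsto:
  assumes T: "T > 0" and cont: "continuous_on {0..T} f"
  shows "(\<lambda>n. mdist (C_metric T) (bernstein_path T n (\<lambda>k. f (grid_time T n k))) (\<lambda>t\<in>{0..T}. f t)) \<longlonglongrightarrow> 0"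
proof (rule LIMSEQ_I)
  fix e :: real assume "e > 0"
  then have e: "e / 2 > 0" by simp
  have "continuous_on {0..1} (\<lambda>s. f (T * s))"
    using T by (intro continuous_on_compose2[OF cont] continuous_intros) (auto intro: mult_left_le)
  from Bernstein_Weierstrass[OF this e] obtain N where
    N: "\<And>n x. N \<le> n \<Longrightarrow> x \<in> {0..1} \<Longrightarrow> \<bar>f (T * x) - (\<Sum>k\<le>n. f (T * (k / n)) * Bernstein n k x)\<bar> < e / 2"
    by blast
  show "\<exists>N. \<forall>n\<ge>N. norm (mdist (C_metric T) (bernstein_path T n (\<lambda>k. f (grid_time T n k))) (\<lambda>t\<in>{0..T}. f t) - 0) < e"
  proof (intro exI allI impI)
    fix n assume n: "N \<le> n"
    have "mdist (C_metric T) (bernstein_path T n (\<lambda>k. f (grid_time T n k))) (\<lambda>t\<in>{0..T}. f t) \<le> e / 2"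
    proof (rule C_dist_le)
      fix t assume t: "t \<in> {0..T}"
      have "bernstein_path T n (\<lambda>k. f (grid_time T n k)) t = (\<Sum>k\<le>n. f (T * (k / n)) * Bernstein n k (t / T))"
        using t unfolding bernstein_path_def grid_time_def by (auto intro!: sum.cong simp: min_def)
      moreover have "T * (t / T) = t" using T by simp
      ultimately show "\<bar>bernstein_path T n (\<lambda>k. f (grid_time T n k)) t - (\<lambda>t\<in>{0..T}. f t) t\<bar> \<le> e / 2"
        using N[OF n, of "t / T"] t T by (simp add: abs_minus_commute)
    qed (use e in simp)
    then show "norm (mdist (C_metric T) (bernstein_path T n (\<lambda>k. f (grid_time T n k))) (\<lambda>t\<in>{0..T}. f t) - 0) < e"
      using \<open>e > 0\<close> by simp
  qed
qed

text \<open>A path of degree \<open>n\<close> has \<open>Suc n\<close> nodes and depends on them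
  with Lipschitz constant 1 in the l1 distance. The first claim stands apart from monotonicity
  because it also has to serve indicators of open sets when the measurability of paths is
  proved.\<close>

lemma envelope_bernstein:
  assumes T: "T > 0" and L: "L \<ge> 0" and b: "\<forall>\<alpha>\<in>C_space T. \<bar>F \<alpha>\<bar> \<le> b"
  shows "l1_lipschitz (Suc n) L (\<lambda>x. lipschitz_envelope T L F (bernstein_path T n x))"
    and "monotone_on (C_space T) (C_le T) (\<le>) F \<Longrightarrow>
      bounded_mono_lipschitz (Suc n) b L (\<lambda>x. lipschitz_envelope T L F (bernstein_path T n x))"
proof -
  note env = L b
  show 1: "l1_lipschitz (Suc n) L (\<lambda>x. lipschitz_envelope T L F (bernstein_path T n x))"
    unfolding l1_lipschitz_def
  proof (intro allI)
    fix x y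
    show "\<bar>lipschitz_envelope T L F (bernstein_path T n x) - lipschitz_envelope T L F (bernstein_path T n y)\<bar>
        \<le> L * (\<Sum>i<Suc n. \<bar>x i - y i\<bar>)"
      by (rule order_trans[OF envelope_lipschitz[OF env bernstein_path_in bernstein_path_in]])
        (intro mult_left_mono bernstein_path_lipschitz T L)
  qed
  assume F: "monotone_on (C_space T) (C_le T) (\<le>) F"
  show "bounded_mono_lipschitz (Suc n) b L (\<lambda>x. lipschitz_envelope T L F (bernstein_path T n x))"
    unfolding bounded_mono_lipschitz_def
  proof (intro conjI allI monoI 1)
    show "\<bar>lipschitz_envelope T L F (bernstein_path T n x)\<bar> \<le> b" for x
      by (rule envelope_bounded[OF env bernstein_path_in])
    show "lipschitz_envelope T L F (bernstein_path T n x) \<le> lipschitz_envelope T L F (bernstein_path T n y)"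
      if "x \<le> y" for x y
      by (rule envelope_mono[OF env F bernstein_path_in bernstein_path_in bernstein_path_mono[OF T that]])
  qed
qed

section \<open>Passage from grid values to whole paths\<close>

locale continuous_path_process = prob_space M for M :: "'a measure" +
  fixes T :: real and X :: "real \<Rightarrow> 'a \<Rightarrow> real"
  assumes T: "T > 0" and process: "continuous_process M T X"
begin

definition grid_values :: "nat \<Rightarrow> 'a \<Rightarrow> nat \<Rightarrow> real" where
  "grid_values n \<omega> k = X (grid_time T n k) \<omega>"

lemma grid_values_measurable: "grid_values n \<in> borel_measurable M"
proof (rule measurable_coordinatewise_then_product)
  show "(\<lambda>\<omega>. grid_values n \<omega> k) \<in> borel_measurable M" for k
    using process grid_time_in[of T n k] T unfolding continuous_process_def grid_values_def by auto
qed

lemma sample_path_in: "\<omega> \<in> space M \<Longrightarrow> sample_path T X \<omega> \<in> C_space T"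
  using process unfolding continuous_process_def sample_path_def by (intro C_spaceI) auto

lemma envelope_discretization:
  assumes L: "L \<ge> 0" and b: "\<forall>\<alpha>\<in>C_space T. \<bar>F \<alpha>\<bar> \<le> b" and \<omega>: "\<omega> \<in> space M"
  shows "(\<lambda>n. lipschitz_envelope T L F (bernstein_path T n (grid_values n \<omega>))) \<longlonglongrightarrow>
    lipschitz_envelope T L F (sample_path T X \<omega>)"
proof -
  have c: "continuous_on {0..T} (\<lambda>t. X t \<omega>)" using process \<omega> by (auto simp: continuous_process_def)
  have "(\<lambda>n. L * mdist (C_metric T) (bernstein_path T n (grid_values n \<omega>)) (sample_path T X \<omega>)) \<longlonglongrightarrow> L * 0"
    using bernstein_path_tendsto[OF T c] unfolding sample_path_def grid_values_def[abs_def]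
    by (intro tendsto_mult tendsto_const) simp
  then have lim: "(\<lambda>n. L * mdist (C_metric T) (bernstein_path T n (grid_values n \<omega>)) (sample_path T X \<omega>)) \<longlonglongrightarrow> 0"
    by (simp only: mult_zero_right)
  have "norm (lipschitz_envelope T L F (bernstein_path T n (grid_values n \<omega>)) - lipschitz_envelope T L F (sample_path T X \<omega>))
      \<le> L * mdist (C_metric T) (bernstein_path T n (grid_values n \<omega>)) (sample_path T X \<omega>)" for n
    unfolding real_norm_def by (rule envelope_lipschitz[OF L b bernstein_path_in sample_path_in[OF \<omega>]])
  then have "(\<lambda>n. lipschitz_envelope T L F (bernstein_path T n (grid_values n \<omega>)) -
      lipschitz_envelope T L F (sample_path T X \<omega>)) \<longlonglongrightarrow> 0"
    by (intro Lim_null_comparison[OF _ lim] always_eventually allI)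
  then show ?thesis by (rule LIM_zero_cancel)
qed

text \<open>Before discretization is undone, only finitely many values of the process enter, through
  a Lipschitz function; the second claim follows as a pointwise limit. Neither measurability of
  \<open>F\<close> nor of the path map is presupposed, so the latter can be derived from it without
  circularity.\<close>

lemma envelope_measurable:
  assumes L: "L \<ge> 0" and b: "\<forall>\<alpha>\<in>C_space T. \<bar>F \<alpha>\<bar> \<le> b"
  shows "(\<lambda>\<omega>. lipschitz_envelope T L F (bernstein_path T n (grid_values n \<omega>))) \<in> borel_measurable M"
    and "(\<lambda>\<omega>. lipschitz_envelope T L F (sample_path T X \<omega>)) \<in> borel_measurable M"
proof -
  show *: "(\<lambda>\<omega>. lipschitz_envelope T L F (bernstein_path T n (grid_values n \<omega>))) \<in> borel_measurable M" for n
    by (rule measurable_compose[OF grid_values_measurable l1_lipschitz_measurable[OF envelope_bernstein(1)[OF T L b]]])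
  show "(\<lambda>\<omega>. lipschitz_envelope T L F (sample_path T X \<omega>)) \<in> borel_measurable M"
    by (rule borel_measurable_LIMSEQ_real[OF envelope_discretization[OF L b] *])
qed

text \<open>An open set is where the Lipschitz envelope of its indicator is positive, so separability of
  the path space is not needed.\<close>

lemma sample_path_measurable: "sample_path T X \<in> measurable M (C_borel T)"
  unfolding C_borel_def
proof (rule measurable_measure_of)
  interpret C: Metric_space "C_space T" "mdist (C_metric T)" by simp
  show "{U. openin (C_topology T) U} \<subseteq> Pow (C_space T)"
    using C.openin_mtopology by (auto simp: mtopology_of_def)
  show "sample_path T X \<in> space M \<rightarrow> C_space T" using sample_path_in by auto
  fix U assume "U \<in> {U. openin (C_topology T) U}"
  then have U: "\<And>\<alpha>. \<alpha> \<in> U \<Longrightarrow> \<exists>r>0. C.mball \<alpha> r \<subseteq> U" "U \<subseteq> C_space T"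
    by (auto simp: mtopology_of_def C.openin_mtopology)
  let ?h = "lipschitz_envelope T 1 (indicator U)"
  have b: "\<forall>\<alpha>\<in>C_space T. \<bar>indicator U \<alpha> :: real\<bar> \<le> 1" by (simp add: indicator_def)
  have pos: "\<alpha> \<in> U \<longleftrightarrow> 0 < ?h \<alpha>" if \<alpha>: "\<alpha> \<in> C_space T" for \<alpha>
  proof
    assume "\<alpha> \<in> U"
    then obtain r where r: "r > 0" "C.mball \<alpha> r \<subseteq> U" using U by blast
    \<comment> \<open>Competitors inside \<open>U\<close> pay the indicator value 1, those outside
      pay their distance, at least \<open>r\<close>.\<close>
    have "min r 1 \<le> ?h \<alpha>"
    proof (rule envelope_greatest[OF _ b])
      fix \<beta> assume \<beta>: "\<beta> \<in> C_space T"
      show "min r 1 \<le> indicator U \<beta> + 1 * mdist (C_metric T) \<alpha> \<beta>"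
      proof (cases "\<beta> \<in> U")
        case True
        then show ?thesis by (simp add: min.coboundedI2)
      next
        case False
        then have "\<not> mdist (C_metric T) \<alpha> \<beta> < r" using r(2) \<alpha> \<beta> by (auto simp: C.in_mball)
        then show ?thesis using False by simp
      qed
    qed simp
    then show "0 < ?h \<alpha>" using r(1) by linarith
  next
    assume "0 < ?h \<alpha>"
    also have "?h \<alpha> \<le> indicator U \<alpha>" by (rule envelope_le[OF _ b \<alpha>]) simp
    finally show "\<alpha> \<in> U" by (simp add: indicator_def split: if_splits)
  qed
  have "sample_path T X -` U \<inter> space M = {\<omega> \<in> space M. 0 < ?h (sample_path T X \<omega>)}"
    using pos sample_path_in by auto
  also have "\<dots> \<in> sets M"
    using envelope_measurable(2)[of 1 "indicator U" 1] b by measurable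
  finally show "sample_path T X -` U \<inter> space M \<in> sets M" .
qed

lemma as_continuousD:
  assumes "as_continuous T (path_law M T X) F"
  shows "AE \<omega> in M. topcontinuous_at (C_topology T) euclidean F (sample_path T X \<omega>)"
proof -
  obtain A where A: "A \<in> sets (C_borel T)" "measure (path_law M T X) A = 1"
    "\<And>\<alpha>. \<alpha> \<in> A \<Longrightarrow> topcontinuous_at (C_topology T) euclidean F \<alpha>"
    using assms unfolding as_continuous_def path_law_def by auto
  have "prob (sample_path T X -` A \<inter> space M) = 1"
    using A(2) unfolding path_law_def by (subst (asm) measure_distr[OF sample_path_measurable A(1)])
  then have "AE \<omega> in M. \<omega> \<in> sample_path T X -` A \<inter> space M"
    using measurable_sets[OF sample_path_measurable A(1)] by (subst prob_eq_1[symmetric])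
  then show ?thesis using A(3) by (elim eventually_mono) auto
qed

text \<open>The limits are taken in a fixed order: for a given Lipschitz constant \<open>k\<close>
  the degree \<open>n\<close> of the Bernstein paths tends to infinity, and only then does
  \<open>k\<close>. Gaussianity is absent here; the correlation inequality for the grid values is
  supplied by \<open>assoc\<close>.\<close>

lemma comonotony_of_grid_association:
  assumes assoc: "\<And>n b L f g. L \<ge> 0 \<Longrightarrow> bounded_mono_lipschitz (Suc n) b L f \<Longrightarrow> bounded_mono_lipschitz (Suc n) b L g \<Longrightarrow>
      (\<integral>\<omega>. f (grid_values n \<omega>) \<partial>M) * (\<integral>\<omega>. g (grid_values n \<omega>) \<partial>M) \<le> (\<integral>\<omega>. f (grid_values n \<omega>) * g (grid_values n \<omega>) \<partial>M)"
    and F: "F \<in> borel_measurable (C_borel T)" "monotone_on (C_space T) (C_le T) (\<le>) F"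
      "\<forall>\<alpha>\<in>C_space T. \<bar>F \<alpha>\<bar> \<le> b" "as_continuous T (path_law M T X) F"
    and G: "G \<in> borel_measurable (C_borel T)" "monotone_on (C_space T) (C_le T) (\<le>) G"
      "\<forall>\<alpha>\<in>C_space T. \<bar>G \<alpha>\<bar> \<le> b" "as_continuous T (path_law M T X) G"
  shows "(\<integral>\<omega>. F (sample_path T X \<omega>) \<partial>M) * (\<integral>\<omega>. G (sample_path T X \<omega>) \<partial>M) \<le>
    (\<integral>\<omega>. F (sample_path T X \<omega>) * G (sample_path T X \<omega>) \<partial>M)"
proof -
  have prod_bound: "\<bar>s * t\<bar> \<le> b * b" if "\<bar>s\<bar> \<le> b" "\<bar>t\<bar> \<le> b" for s t :: real
    unfolding abs_mult using that by (intro mult_mono) auto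
  \<comment> \<open>Dominated convergence with constant majorants, for both limits. Convergence is
    asked only almost everywhere, since in the second limit it holds only where the functionals are
    continuous.\<close>
  have limits: "(\<integral>\<omega>. u \<omega> \<partial>M) * (\<integral>\<omega>. v \<omega> \<partial>M) \<le> (\<integral>\<omega>. u \<omega> * v \<omega> \<partial>M)"
    if m: "\<And>k. U k \<in> borel_measurable M" "\<And>k. V k \<in> borel_measurable M" "u \<in> borel_measurable M" "v \<in> borel_measurable M"
      and bd: "\<And>k \<omega>. \<omega> \<in> space M \<Longrightarrow> \<bar>U k \<omega>\<bar> \<le> b" "\<And>k \<omega>. \<omega> \<in> space M \<Longrightarrow> \<bar>V k \<omega>\<bar> \<le> b"
      and lim: "AE \<omega> in M. (\<lambda>k. U k \<omega>) \<longlonglongrightarrow> u \<omega>" "AE \<omega> in M. (\<lambda>k. V k \<omega>) \<longlonglongrightarrow> v \<omega>"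
      and le: "\<And>k. (\<integral>\<omega>. U k \<omega> \<partial>M) * (\<integral>\<omega>. V k \<omega> \<partial>M) \<le> (\<integral>\<omega>. U k \<omega> * V k \<omega> \<partial>M)"
    for U V :: "nat \<Rightarrow> 'a \<Rightarrow> real" and u v
  proof (rule LIMSEQ_le)
    note [measurable] = m
    show "(\<lambda>k. (\<integral>\<omega>. U k \<omega> \<partial>M) * (\<integral>\<omega>. V k \<omega> \<partial>M)) \<longlonglongrightarrow> (\<integral>\<omega>. u \<omega> \<partial>M) * (\<integral>\<omega>. v \<omega> \<partial>M)"
      using bd lim by (intro tendsto_mult integral_dominated_convergence[where w = "\<lambda>_. b"]) auto
    show "(\<lambda>k. \<integral>\<omega>. U k \<omega> * V k \<omega> \<partial>M) \<longlonglongrightarrow> (\<integral>\<omega>. u \<omega> * v \<omega> \<partial>M)"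
    proof (rule integral_dominated_convergence[where w = "\<lambda>_. b * b"])
      show "AE \<omega> in M. (\<lambda>k. U k \<omega> * V k \<omega>) \<longlonglongrightarrow> u \<omega> * v \<omega>"
        using lim by eventually_elim (rule tendsto_mult)
      show "AE \<omega> in M. norm (U k \<omega> * V k \<omega>) \<le> b * b" for k
        using bd by (intro AE_I2) (simp only: real_norm_def prod_bound)
    qed auto
    show "\<exists>N. \<forall>k\<ge>N. (\<integral>\<omega>. U k \<omega> \<partial>M) * (\<integral>\<omega>. V k \<omega> \<partial>M) \<le> (\<integral>\<omega>. U k \<omega> * V k \<omega> \<partial>M)"
      using le by blast
  qed
  let ?e = "\<lambda>H k \<omega>. lipschitz_envelope T (real k) H (sample_path T X \<omega>)"
  have k0: "0 \<le> real k" for k by simp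
  have lipschitz: "(\<integral>\<omega>. ?e F k \<omega> \<partial>M) * (\<integral>\<omega>. ?e G k \<omega> \<partial>M) \<le> (\<integral>\<omega>. ?e F k \<omega> * ?e G k \<omega> \<partial>M)" for k
    by (rule limits[of "\<lambda>n \<omega>. lipschitz_envelope T (real k) F (bernstein_path T n (grid_values n \<omega>))"
            "\<lambda>n \<omega>. lipschitz_envelope T (real k) G (bernstein_path T n (grid_values n \<omega>))"])
      (intro envelope_measurable[OF k0 F(3)] envelope_measurable[OF k0 G(3)]
        envelope_bounded[OF k0 F(3)] envelope_bounded[OF k0 G(3)] bernstein_path_in
        AE_I2 envelope_discretization[OF k0 F(3)] envelope_discretization[OF k0 G(3)]
        assoc[OF k0 envelope_bernstein(2)[OF T k0 F(3) F(2)] envelope_bernstein(2)[OF T k0 G(3) G(2)]]; assumption)+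
  have ae: "AE \<omega> in M. (\<lambda>k. ?e H k \<omega>) \<longlonglongrightarrow> H (sample_path T X \<omega>)"
    if "\<forall>\<alpha>\<in>C_space T. \<bar>H \<alpha>\<bar> \<le> b" "as_continuous T (path_law M T X) H" for H
    using as_continuousD[OF that(2)] AE_space
    by eventually_elim (intro envelope_tendsto[OF that(1)] sample_path_in)
  show ?thesis
    by (rule limits[of "?e F" "?e G"])
      (intro envelope_measurable[OF k0 F(3)] envelope_measurable[OF k0 G(3)]
        measurable_compose[OF sample_path_measurable F(1)] measurable_compose[OF sample_path_measurable G(1)]
        envelope_bounded[OF k0 F(3)] envelope_bounded[OF k0 G(3)] sample_path_in
        ae[OF F(3) F(4)] ae[OF G(3) G(4)] lipschitz; assumption)+
qed

end


section \<open>Gaussian processes with nonnegative covariance\<close>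

lemma topcontinuous_at_uminus:
  fixes f :: "'a \<Rightarrow> real"
  assumes "topcontinuous_at X euclidean f x"
  shows "topcontinuous_at X euclidean (\<lambda>x. - f x) x"
  unfolding topcontinuous_at_def
proof (intro conjI allI impI)
  show "x \<in> topspace X" using assms by (simp add: topcontinuous_at_def)
  show "(\<lambda>x. - f x) \<in> topspace X \<rightarrow> topspace euclidean" by simp
  fix V :: "real set" assume V: "openin euclidean V \<and> - f x \<in> V"
  then have "openin euclidean (uminus ` V)" "f x \<in> uminus ` V"
    by (auto simp: open_negations intro: image_eqI[of _ _ "- f x"])
  then obtain U where "openin X U" "x \<in> U" "\<forall>y\<in>U. f y \<in> uminus ` V"
    using assms unfolding topcontinuous_at_def by blast
  then show "\<exists>U. openin X U \<and> x \<in> U \<and> (\<forall>y\<in>U. - f y \<in> V)"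
    by (intro exI[of _ U]) auto
qed

text \<open>\<open>\<bar>t - s\<bar>\<close> is at most the larger of the two times, so the
  subtracted power is bounded by one of the two added powers.\<close>

lemma fbm_covariance_nonneg:
  assumes "s \<ge> 0" "t \<ge> 0" "H > 0"
  shows "fbm_covariance H s t \<ge> 0"
proof -
  have "\<bar>t - s\<bar> powr (2 * H) \<le> max s t powr (2 * H)"
    using assms by (intro powr_mono2) auto
  also have "\<dots> \<le> t powr (2 * H) + s powr (2 * H)"
    by (simp add: max_def)
  finally show ?thesis by (simp add: fbm_covariance_def)
qed

theorem comonotony_gaussian_process:
  fixes M :: "'w measure" and X :: "real \<Rightarrow> 'w \<Rightarrow> real"
  assumes M: "prob_space M" and T: "T > 0"
    and process: "continuous_process M T X" and gaussian: "gaussian_process M T X" and centered: "centered M T X"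
    and cov: "\<And>s t. s \<in> {0..T} \<Longrightarrow> t \<in> {0..T} \<Longrightarrow> 0 \<le> covariance M (X s) (X t)"
  shows "functional_comonotony_principle M T X"
proof -
  interpret prob_space M by fact
  interpret continuous_path_process M T X using T process by unfold_locales
  have lin: "\<exists>\<mu> \<sigma>. \<sigma> \<ge> 0 \<and> distr M borel (\<lambda>\<omega>. \<Sum>t\<in>I. c t * X t \<omega>) = gaussian_measure \<mu> \<sigma>"
    if "finite I" "I \<subseteq> {0..T}" for I c
    using gaussian that unfolding gaussian_process_def gaussian_variable_def by blast
  have meas: "X t \<in> borel_measurable M" and mean: "(\<integral>\<omega>. X t \<omega> \<partial>M) = 0" if "t \<in> {0..T}" for t
    using process centered that by (auto simp: continuous_process_def centered_def)
  have int: "integrable M (X t)" if "t \<in> {0..T}" for t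
    using lin[of "{t}" "\<lambda>_. 1"] gaussian_measure_mean(1)[OF meas[OF that]] that by auto
  \<comment> \<open>The mean parameter of each Gaussian linear form is its expectation, which
    vanishes by linearity.\<close>
  have lin0: "\<exists>\<sigma>\<ge>0. distr M borel (\<lambda>\<omega>. \<Sum>t\<in>I. c t * X t \<omega>) = gaussian_measure 0 \<sigma>"
    if I: "finite I" "I \<subseteq> {0..T}" for I c
  proof -
    obtain \<mu> \<sigma> where \<sigma>: "\<sigma> \<ge> 0" "distr M borel (\<lambda>\<omega>. \<Sum>t\<in>I. c t * X t \<omega>) = gaussian_measure \<mu> \<sigma>"
      using lin[OF I] by blast
    have "(\<lambda>\<omega>. \<Sum>t\<in>I. c t * X t \<omega>) \<in> borel_measurable M"
      using I meas by (intro borel_measurable_sum borel_measurable_times) auto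
    from gaussian_measure_mean(2)[OF this \<sigma>] have "\<mu> = (\<Sum>t\<in>I. c t * (\<integral>\<omega>. X t \<omega> \<partial>M))"
      using I int by (subst (asm) Bochner_Integration.integral_sum) (auto simp: subset_iff)
    also have "\<dots> = 0" using mean I by (intro sum.neutral) auto
    finally show ?thesis using \<sigma> by blast
  qed
  have seq: "positively_correlated_gaussian_sequence M (grid_values n)" for n
  proof
    show "grid_values n \<in> borel_measurable M" by (rule grid_values_measurable)
  next
    fix S and c :: "nat \<Rightarrow> real" assume S: "finite (S :: nat set)"
    \<comment> \<open>Distinct indices can share a grid time, as all indices from \<open>n\<close>
      on do, while \<open>gaussian_process\<close> sums over sets of times; coefficients belonging
      to the same time are therefore added up.\<close>
    let ?t = "grid_time T n" and ?c = "\<lambda>t. sum c {i \<in> S. grid_time T n i = t}"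
    have "(\<Sum>i\<in>S. c i * grid_values n \<omega> i) = (\<Sum>t\<in>?t ` S. ?c t * X t \<omega>)" for \<omega>
      unfolding grid_values_def sum_distrib_right
      by (subst sum.image_gen[OF S, of _ ?t]) (auto intro!: sum.cong)
    then show "\<exists>\<sigma>\<ge>0. distr M borel (\<lambda>\<omega>. \<Sum>i\<in>S. c i * grid_values n \<omega> i) = gaussian_measure 0 \<sigma>"
      using lin0[of "?t ` S" ?c] S grid_time_in T by (simp add: image_subset_iff)
  next
    fix i j
    have "grid_time T n i \<in> {0..T}" "grid_time T n j \<in> {0..T}" using grid_time_in T by auto
    with cov[OF this] show "0 \<le> (\<integral>\<omega>. grid_values n \<omega> i * grid_values n \<omega> j \<partial>M)"
      by (simp only: covariance_def mean grid_values_def diff_0_right)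
  qed
  note assoc = positively_correlated_gaussian_sequence.association[OF seq]
  have principle: "(\<integral>\<omega>. F (sample_path T X \<omega>) \<partial>M) * (\<integral>\<omega>. G (sample_path T X \<omega>) \<partial>M)
        \<le> (\<integral>\<omega>. F (sample_path T X \<omega>) * G (sample_path T X \<omega>) \<partial>M)"
    if "F \<in> borel_measurable (C_borel T)" "G \<in> borel_measurable (C_borel T)"
      "monotone_on (C_space T) (C_le T) (\<le>) F" "monotone_on (C_space T) (C_le T) (\<le>) G"
      "\<forall>\<alpha>\<in>C_space T. \<bar>F \<alpha>\<bar> \<le> b" "\<forall>\<alpha>\<in>C_space T. \<bar>G \<alpha>\<bar> \<le> b"
      "as_continuous T (path_law M T X) F" "as_continuous T (path_law M T X) G" for F G b
    by (rule comonotony_of_grid_association[OF assoc that(1,3,5,7,2,4,6,8)])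
  have bdd: "\<exists>b. (\<forall>\<alpha>\<in>C_space T. \<bar>F \<alpha>\<bar> \<le> b) \<and> (\<forall>\<alpha>\<in>C_space T. \<bar>G \<alpha>\<bar> \<le> b)"
    if bd: "bounded (F ` C_space T)" "bounded (G ` C_space T)" for F G :: "(real \<Rightarrow> real) \<Rightarrow> real"
  proof -
    obtain b c where "\<forall>\<alpha>\<in>C_space T. \<bar>F \<alpha>\<bar> \<le> b" "\<forall>\<alpha>\<in>C_space T. \<bar>G \<alpha>\<bar> \<le> c"
      using bd by (auto simp: bounded_iff)
    then show ?thesis by (intro exI[of _ "max b c"]) (auto simp: le_max_iff_disj)
  qed
  show ?thesis
    unfolding functional_comonotony_principle_def
  proof (intro allI impI)
    fix F G :: "(real \<Rightarrow> real) \<Rightarrow> real"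
    assume meas': "F \<in> borel_measurable (C_borel T)" "G \<in> borel_measurable (C_borel T)"
      and bd: "bounded (F ` C_space T)" "bounded (G ` C_space T)" and como: "comonotone T F G"
      and cont: "as_continuous T (path_law M T X) F" "as_continuous T (path_law M T X) G"
    obtain b where b: "\<forall>\<alpha>\<in>C_space T. \<bar>F \<alpha>\<bar> \<le> b" "\<forall>\<alpha>\<in>C_space T. \<bar>G \<alpha>\<bar> \<le> b"
      using bdd[OF bd] by blast
    show "(\<integral>\<omega>. F (sample_path T X \<omega>) \<partial>M) * (\<integral>\<omega>. G (sample_path T X \<omega>) \<partial>M)
        \<le> (\<integral>\<omega>. F (sample_path T X \<omega>) * G (sample_path T X \<omega>) \<partial>M)"
      using como unfolding comonotone_def
    proof (elim disjE conjE)
      assume "monotone_on (C_space T) (C_le T) (\<le>) F" "monotone_on (C_space T) (C_le T) (\<le>) G"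
      with meas' show ?thesis by (rule principle[OF _ _ _ _ b cont])
    next
      \<comment> \<open>Negating both functionals makes them non-decreasing and leaves both sides of
        the inequality unchanged.\<close>
      assume "monotone_on (C_space T) (C_le T) (\<ge>) F" "monotone_on (C_space T) (C_le T) (\<ge>) G"
      then have "monotone_on (C_space T) (C_le T) (\<le>) (\<lambda>\<alpha>. - F \<alpha>)" "monotone_on (C_space T) (C_le T) (\<le>) (\<lambda>\<alpha>. - G \<alpha>)"
        by (simp_all add: monotone_on_def)
      moreover have neg: "as_continuous T (path_law M T X) (\<lambda>\<alpha>. - H \<alpha>)" if "as_continuous T (path_law M T X) H" for H
      proof -
        obtain A where "A \<in> sets (path_law M T X)" "measure (path_law M T X) A = 1"
          "\<forall>\<alpha>\<in>A. topcontinuous_at (C_topology T) euclidean H \<alpha>"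
          using \<open>as_continuous T (path_law M T X) H\<close> unfolding as_continuous_def by blast
        then show ?thesis
          unfolding as_continuous_def by (intro bexI[of _ A] conjI ballI topcontinuous_at_uminus) auto
      qed
      ultimately have "(\<integral>\<omega>. - F (sample_path T X \<omega>) \<partial>M) * (\<integral>\<omega>. - G (sample_path T X \<omega>) \<partial>M)
        \<le> (\<integral>\<omega>. - F (sample_path T X \<omega>) * - G (sample_path T X \<omega>) \<partial>M)"
        using b by (intro principle[of "\<lambda>\<alpha>. - F \<alpha>" "\<lambda>\<alpha>. - G \<alpha>" b] borel_measurable_uminus meas' neg cont) auto
      then show ?thesis by simp
    qed
  qed
qed

theorem mainTheorem9:
  fixes M :: "'w measure" and T H :: real and B :: "real \<Rightarrow> 'w \<Rightarrow> real"
  assumes "prob_space M" and "T > 0" and "0 < H" and "H \<le> 1"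
    and "fractional_brownian_motion M T H B"
  shows "functional_comonotony_principle M T B"
  using assms unfolding fractional_brownian_motion_def
  by (intro comonotony_gaussian_process) (auto simp: fbm_covariance_nonneg)

end
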